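(* Let $d\ge2$, $1<p<\infty$, $A,B_\infty\in\mathbb C^{m,m}$ and $S\in\mathbb R^{d,d}$ skew-symmetric. Assume (A4$_p$) for $A$, that $A$ and $B_\infty$ are simultaneously diagonalizable over $\mathbb C$, and that $Q\in L^\infty(\mathbb R^d,\mathbb C^{m,m})$ satisfies $\eta_R:=\operatorname{ess\,sup}_{|x|\ge R}|Q(x)|\to0$ as $R\to\infty$. Let $\pm i\sigma_1,\dots,\pm i\sigma_k$ ($\sigma_j\in\mathbb R$) be the nonzero eigenvalues of $S$, $\sigma=(\sigma_1,\dots,\sigma_k)$. Then the dispersion set $$\sigma_{\rm disp}(\mathcal L_Q)=\{\lambda\in\mathbb C:\ \det\big(\lambda I_m+(|\omega|^2+|\rho|^2)A+i\langle n,\sigma\rangle I_m+B_\infty\big)=0\text{ for some }\omega\in\mathbb R^k,\rho\in\mathbb R^{d-2k},n\in\mathbb Z^k\}$$ is contained in the essential spectrum $\sigma_{\rm ess}(\mathcal L_Q)$ of $\mathcal L_Q$ in $L^p(\mathbb R^d,\mathbb C^m)$.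
   Context: Inner product on $\mathbb C^m$: $\langle u,v\rangle=u^{H}v$ with $u^H=\bar u^\top$. Condition (A4$_p$) for a matrix $A\in\mathbb C^{m,m}$ and $1<p<\infty$: there is $\gamma_A>0$ such that $|z|^2\Re\langle w,Aw\rangle+(p-2)\Re\langle w,z\rangle\Re\langle z,Aw\rangle\ge\gamma_A|z|^2|w|^2$ for all $z,w\in\mathbb C^m$. For $x\in\mathbb R^d$, $\langle Sx,\nabla v(x)\rangle=\sum_{i,j=1}^dS_{ij}x_j\partial_{x_i}v(x)$. The Ornstein–Uhlenbeck operator is $\mathcal L_0v=A\Delta v+\langle Sx,\nabla v\rangle$ with domain $\mathcal D^p_{\rm loc}(\mathcal L_0)=\{v\in W^{2,p}_{\rm loc}(\mathbb R^d,\mathbb C^m)\cap L^p(\mathbb R^d,\mathbb C^m):\mathcal L_0v\in L^p(\mathbb R^d,\mathbb C^m)\}$ and graph norm $\|v\|_{\mathcal L_0}=\|\mathcal L_0v\|_{L^p}+\|v\|_{L^p}$. The operator $\mathcal L_Q$ is $\mathcal L_Qv(x)=A\Delta v(x)+\langle Sx,\nabla v(x)\rangle-B_\infty v(x)+Q(x)v(x)$ in $L^p(\mathbb R^d,\mathbb C^m)$ with domain $\mathcal D^p_{\rm loc}(\mathcal L_0)$. Spectral notions for a closed densely defined operator $\mathcal A$ on a complex Banach space: $\sigma(\mathcal A)$ is the complement of the resolvent set; the point spectrum $\sigma_{\rm pt}(\mathcal A)$ is the set of $\lambda\in\sigma(\mathcal A)$ that are isolated in $\sigma(\mathcal A)$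 and are eigenvalues of finite multiplicity (i.e. $\bigcup_{k\in\mathbb N}\mathcal N((\lambda I-\mathcal A)^k)$ is finite-dimensional); the essential spectrum is $\sigma_{\rm ess}(\mathcal A)=\sigma(\mathcal A)\setminus\sigma_{\rm pt}(\mathcal A)$. *)

theory Defs
  imports "HOL-Analysis.Analysis"
begin

text \<open>Functions R^d -> C^m are modelled as functions of type real^'d => complex^'m;
  elements of L^p are such functions, and equality in L^p is equality a.e.
  (w.r.t. Lebesgue measure).  Unbounded operators are modelled as relations
  T v w meaning: v is in the domain and the operator maps v to (the class of) w.\<close>

type_synonym ('d,'m) vfun = "real^'d::finite \<Rightarrow> complex^'m::finite"

definition cinner :: "complex^'m \<Rightarrow> complex^'m \<Rightarrow> complex" where
  "cinner u v = (\<Sum>i\<in>UNIV. cnj (u$i) * v$i)"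

definition cond_A4 :: "real \<Rightarrow> complex^'m^'m \<Rightarrow> bool" where
  "cond_A4 p A \<longleftrightarrow> (\<exists>\<gamma>>0. \<forall>z w :: complex^'m.
      (norm z)^2 * Re (cinner w (A *v w)) + (p - 2) * Re (cinner w z) * Re (cinner z (A *v w))
        \<ge> \<gamma> * (norm z)^2 * (norm w)^2)"

definition is_diag :: "complex^'m^'m \<Rightarrow> bool" where
  "is_diag M \<longleftrightarrow> (\<forall>i j. i \<noteq> j \<longrightarrow> M$i$j = 0)"

definition simult_diagonalizable :: "complex^'m^'m \<Rightarrow> complex^'m^'m \<Rightarrow> bool" where
  "simult_diagonalizable A B \<longleftrightarrow> (\<exists>Y Yi :: complex^'m^'m. Y ** Yi = mat 1 \<and> Yi ** Y = mat 1 \<and>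
      is_diag (Yi ** A ** Y) \<and> is_diag (Yi ** B ** Y))"

definition Lp :: "real \<Rightarrow> ('a::euclidean_space \<Rightarrow> 'b::euclidean_space) \<Rightarrow> bool" where
  "Lp p f \<longleftrightarrow> f \<in> borel_measurable lebesgue \<and> integrable lebesgue (\<lambda>x. norm (f x) powr p)"

definition Lp_loc :: "real \<Rightarrow> ('a::euclidean_space \<Rightarrow> 'b::euclidean_space) \<Rightarrow> bool" where
  "Lp_loc p f \<longleftrightarrow> f \<in> borel_measurable lebesgue \<and>
     (\<forall>K. compact K \<longrightarrow> set_integrable lebesgue K (\<lambda>x. norm (f x) powr p))"

definition Lp_norm :: "real \<Rightarrow> ('a::euclidean_space \<Rightarrow> 'b::euclidean_space) \<Rightarrow> real" where
  "Lp_norm p f = (\<integral>x. norm (f x) powr p \<partial>lebesgue) powr (1/p)"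

text \<open>Test functions C_c^\<infinity>(R^d, R): D \<alpha> is the iterated partial derivative along the
  list of coordinate directions \<alpha>; all of them exist and are continuous.\<close>
definition smooth_fun :: "(real^'d \<Rightarrow> real) \<Rightarrow> bool" where
  "smooth_fun \<phi> \<longleftrightarrow> (\<exists>D :: 'd list \<Rightarrow> real^'d \<Rightarrow> real. D [] = \<phi> \<and>
      (\<forall>\<alpha>. continuous_on UNIV (D \<alpha>)) \<and>
      (\<forall>\<alpha> i x. ((\<lambda>t. D \<alpha> (x + t *\<^sub>R axis i 1)) has_real_derivative D (i # \<alpha>) x) (at 0)))"

definition test_fun :: "(real^'d \<Rightarrow> real) \<Rightarrow> bool" where
  "test_fun \<phi> \<longleftrightarrow> smooth_fun \<phi> \<and> (\<exists>K. compact K \<and> (\<forall>x. x \<notin> K \<longrightarrow> \<phi> x = 0))"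

definition partial_deriv :: "'d \<Rightarrow> (real^'d \<Rightarrow> real) \<Rightarrow> real^'d \<Rightarrow> real" where
  "partial_deriv i \<phi> x = deriv (\<lambda>t. \<phi> (x + t *\<^sub>R axis i 1)) 0"

definition weak_deriv :: "'d \<Rightarrow> ('d::finite,'m::finite) vfun \<Rightarrow> ('d,'m) vfun \<Rightarrow> bool" where
  "weak_deriv i f g \<longleftrightarrow> (\<forall>\<phi>. test_fun \<phi> \<longrightarrow>
     (\<integral>x. partial_deriv i \<phi> x *\<^sub>R f x \<partial>lebesgue) = - (\<integral>x. \<phi> x *\<^sub>R g x \<partial>lebesgue))"

definition W2p_loc_derivs :: "real \<Rightarrow> ('d::finite,'m::finite) vfun \<Rightarrow> ('d \<Rightarrow> ('d,'m) vfun) \<Rightarrow> ('d \<Rightarrow> 'd \<Rightarrow> ('d,'m) vfun) \<Rightarrow> bool" where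
  "W2p_loc_derivs p v g h \<longleftrightarrow> Lp_loc p v \<and> (\<forall>i. Lp_loc p (g i) \<and> weak_deriv i v (g i)) \<and>
     (\<forall>i j. Lp_loc p (h i j) \<and> weak_deriv j (g i) (h i j))"

text \<open>Ornstein-Uhlenbeck expression L_0 v = A \<Delta>v + <Sx, \<nabla>v> evaluated from weak derivatives\<close>
definition OU_expr :: "complex^'m::finite^'m \<Rightarrow> real^'d^'d \<Rightarrow> ('d \<Rightarrow> ('d::finite,'m::finite) vfun) \<Rightarrow> ('d \<Rightarrow> 'd \<Rightarrow> ('d,'m) vfun) \<Rightarrow> ('d,'m) vfun" where
  "OU_expr A S g h = (\<lambda>x. A *v (\<Sum>i\<in>UNIV. h i i x) + (\<Sum>i\<in>UNIV. (\<Sum>j\<in>UNIV. S$i$j * x$j) *\<^sub>R g i x))"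

definition dom_L0 :: "real \<Rightarrow> complex^'m::finite^'m \<Rightarrow> real^'d::finite^'d \<Rightarrow> ('d::finite,'m::finite) vfun set" where
  "dom_L0 p A S = {v. Lp p v \<and> (\<exists>g h. W2p_loc_derivs p v g h \<and> Lp p (OU_expr A S g h))}"

definition LQ :: "real \<Rightarrow> complex^'m^'m \<Rightarrow> real^'d^'d \<Rightarrow> complex^'m^'m \<Rightarrow> (real^'d \<Rightarrow> complex^'m^'m)
     \<Rightarrow> ('d,'m) vfun \<Rightarrow> ('d,'m) vfun \<Rightarrow> bool" where
  "LQ p A S B Q v w \<longleftrightarrow> v \<in> dom_L0 p A S \<and> Lp p w \<and>
     (\<exists>g h. W2p_loc_derivs p v g h \<and>
        (AE x in lebesgue. w x = OU_expr A S g h x - B *v v x + Q x *v v x))"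

definition resolvent_set :: "real \<Rightarrow> (('a::euclidean_space \<Rightarrow> complex^'m) \<Rightarrow> ('a \<Rightarrow> complex^'m) \<Rightarrow> bool) \<Rightarrow> complex set" where
  "resolvent_set p T = {lm.
     (\<forall>f. Lp p f \<longrightarrow> (\<exists>v w. T v w \<and> (AE x in lebesgue. lm *s v x - w x = f x))) \<and>
     (\<exists>C. \<forall>v w. T v w \<longrightarrow> Lp_norm p v \<le> C * Lp_norm p (\<lambda>x. lm *s v x - w x))}"

definition spectrum_op :: "real \<Rightarrow> (('a::euclidean_space \<Rightarrow> complex^'m) \<Rightarrow> ('a \<Rightarrow> complex^'m) \<Rightarrow> bool) \<Rightarrow> complex set" where
  "spectrum_op p T = - resolvent_set p T"

definition kernel_pow :: "(('a::euclidean_space \<Rightarrow> complex^'m) \<Rightarrow> ('a \<Rightarrow> complex^'m) \<Rightarrow> bool) \<Rightarrow> complex \<Rightarrow> nat \<Rightarrow> ('a \<Rightarrow> complex^'m) set" where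
  "kernel_pow T lm k = {v. \<exists>u :: nat \<Rightarrow> 'a \<Rightarrow> complex^'m. u 0 = v \<and>
     (\<forall>j<k. \<exists>w. T (u j) w \<and> (AE x in lebesgue. u (Suc j) x = lm *s u j x - w x)) \<and>
     (AE x in lebesgue. u k x = 0)}"

definition fin_dim_ae :: "('a::euclidean_space \<Rightarrow> complex^'m) set \<Rightarrow> bool" where
  "fin_dim_ae V \<longleftrightarrow> (\<exists>F. finite F \<and> (\<forall>v\<in>V. \<exists>c :: ('a \<Rightarrow> complex^'m) \<Rightarrow> complex.
      AE x in lebesgue. v x = (\<Sum>f\<in>F. c f *s f x)))"

definition point_spectrum :: "real \<Rightarrow> (('a::euclidean_space \<Rightarrow> complex^'m) \<Rightarrow> ('a \<Rightarrow> complex^'m) \<Rightarrow> bool) \<Rightarrow> complex set" where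
  "point_spectrum p T = {lm. lm isolated_in spectrum_op p T \<and> fin_dim_ae (\<Union>k. kernel_pow T lm k)}"

definition ess_spectrum :: "real \<Rightarrow> (('a::euclidean_space \<Rightarrow> complex^'m) \<Rightarrow> ('a \<Rightarrow> complex^'m) \<Rightarrow> bool) \<Rightarrow> complex set" where
  "ess_spectrum p T = spectrum_op p T - point_spectrum p T"

definition disp_set :: "complex^'m^'m \<Rightarrow> complex^'m^'m \<Rightarrow> real list \<Rightarrow> nat \<Rightarrow> complex set" where
  "disp_set A B \<sigma> d = {lm. \<exists>(\<omega>::real list) (\<rho>::real list) (n::int list).
      length \<omega> = length \<sigma> \<and> length \<rho> = d - 2 * length \<sigma> \<and> length n = length \<sigma> \<and>
      det (mat lm + mat (complex_of_real ((\<Sum>t\<leftarrow>\<omega>. t^2) + (\<Sum>t\<leftarrow>\<rho>. t^2))) ** A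
           + mat (\<i> * complex_of_real (\<Sum>j<length \<sigma>. of_int (n!j) * \<sigma>!j)) + B) = 0}"

end

theory Submission
  imports Defs
begin

text \<open>Put \<open>D v = \<langle>Sx, \<nabla>v\<rangle>\<close>, let \<open>z\<close> be a dispersion value with data \<open>(\<kappa>\<^sup>2, \<nu>)\<close>, where
  \<open>\<kappa>\<^sup>2 = |\<omega>|\<^sup>2 + |\<rho>|\<^sup>2\<close> and \<open>\<nu> = \<langle>n, \<sigma>\<rangle>\<close>, and let \<open>u\<close> be a kernel vector of the matrix in the
  dispersion relation.  If \<open>S\<zeta> = i\<tau>\<zeta>\<close>, then skewness gives \<open>D(\<zeta> \<cdot> x) = - i\<tau> (\<zeta> \<cdot> x)\<close>, so a suitable
  product \<open>P\<close> of such linear forms satisfies \<open>D P = - i\<nu> P\<close>, while radial functions are killed by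
  \<open>D\<close>.  Neither independence of the eigenvectors nor a normal form of \<open>S\<close> is needed.  With a
  radial cutoff \<open>X\<close> living on the shell \<open>||y|\<^sup>2 - 1| < \<delta>\<close>, the functions
  \<open>v(x) = (P X)(x/R) exp (i \<kappa> |x|\<^sup>2 / (2R)) u\<close> satisfy \<open>\<parallel>(z - L\<^sub>Q) v\<parallel> \<le> \<epsilon> \<parallel>v\<parallel>\<close> as soon as \<open>\<delta>\<close> is
  small and then \<open>R\<close> is large: the phase gradient has modulus \<open>\<kappa>|x|/R \<approx> \<kappa>\<close> and \<open>Q\<close> is small far
  out.  Hence dispersion values lie in the spectrum.  None is isolated there: for a suitable
  eigenvalue \<open>a\<close> of \<open>A\<close> (nonzero by the (A4) condition), the half-line \<open>z - t a\<close>, \<open>t \<ge> 0\<close>, consists of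
  dispersion values.\<close>

section \<open>Weak derivatives of continuously differentiable functions\<close>

lemma integrable_indicator_cball:
  "integrable lebesgue (\<lambda>x. indicator (cball (0::'a::euclidean_space) r) x *\<^sub>R (c::real))"
  using emeasure_lborel_cball_finite[of "0::'a" r]
  by (intro integrable_scaleR_left integrable_real_indicator) auto

text \<open>The bound is only almost everywhere because the image of a mode under the operator
  contains \<open>Q\<close>, which is controlled only up to null sets.\<close>

lemma Lp_bounded_support:
  fixes f :: "'a::euclidean_space \<Rightarrow> 'b::euclidean_space"
  assumes p: "0 < p" and f: "f \<in> borel_measurable lebesgue"
    and b: "AE x in lebesgue. norm (f x) \<le> M * indicator (cball 0 r) x"
  shows "Lp p f"
proof -
  have [measurable]: "f \<in> borel_measurable lebesgue" by fact
  have "integrable lebesgue (\<lambda>x. norm (f x) powr p)"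
  proof (rule Bochner_Integration.integrable_bound[OF integrable_indicator_cball])
    show "(\<lambda>x. norm (f x) powr p) \<in> borel_measurable lebesgue" by measurable
    show "AE x in lebesgue. norm (norm (f x) powr p) \<le> norm (indicat_real (cball 0 r) x *\<^sub>R \<bar>M\<bar> powr p)"
      using b
    proof eventually_elim
      case (elim x)
      then show ?case using p
        by (cases "x \<in> cball 0 r") (auto intro!: powr_mono2)
    qed
  qed
  then show ?thesis using f by (simp add: Lp_def)
qed

lemma cont_bounded_support:
  fixes f :: "'a::euclidean_space \<Rightarrow> 'b::real_normed_vector"
  assumes c: "continuous_on UNIV f" and s: "\<And>x. norm x > r \<Longrightarrow> f x = 0"
  shows "\<exists>M\<ge>0. (\<forall>x. norm (f x) \<le> M * indicator (cball 0 r) x) \<and> (\<forall>x. norm (f x) \<le> M)"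
proof -
  have "bounded (f ` cball 0 r)"
    by (intro compact_imp_bounded compact_continuous_image continuous_on_subset[OF c]) auto
  then obtain M where "0 < M" and M: "\<And>x. x \<in> cball 0 r \<Longrightarrow> norm (f x) \<le> M"
    by (auto simp: bounded_pos)
  have "norm (f x) \<le> M * indicator (cball 0 r) x" for x
    using M[of x] s[of x] by (cases "x \<in> cball 0 r") auto
  moreover have "norm (f x) \<le> M" for x
    using M[of x] s[of x] \<open>0 < M\<close> by (cases "x \<in> cball 0 r") auto
  ultimately show ?thesis
    using \<open>0 < M\<close> by (intro exI[of _ M]) auto
qed

lemma borel_lebesgue_cont:
  fixes f :: "'a::euclidean_space \<Rightarrow> 'b::euclidean_space"
  assumes "continuous_on UNIV f"
  shows "f \<in> borel_measurable borel" "f \<in> borel_measurable lebesgue"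
  using borel_measurable_continuous_onI[OF assms]
  by (auto intro: measurable_completion)

lemma Lp_cont:
  fixes f :: "'a::euclidean_space \<Rightarrow> 'b::euclidean_space"
  assumes p: "0 < p" and c: "continuous_on UNIV f" and s: "\<And>x. norm x > r \<Longrightarrow> f x = 0"
  shows "Lp p f"
proof -
  obtain M where "\<And>x. norm (f x) \<le> M * indicator (cball 0 r) x"
    using cont_bounded_support[OF c s] by blast
  then show ?thesis
    by (intro Lp_bounded_support[OF p, of f M r] borel_lebesgue_cont c) auto
qed

lemma Lp_loc_cont:
  fixes f :: "'a::euclidean_space \<Rightarrow> 'b::euclidean_space"
  assumes p: "0 < p" and c: "continuous_on UNIV f"
  shows "Lp_loc p f"
  unfolding Lp_loc_def
proof (intro conjI allI impI)
  show "f \<in> borel_measurable lebesgue" by (rule borel_lebesgue_cont[OF c])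
  fix K :: "'a set" assume "compact K"
  have c': "continuous_on UNIV (\<lambda>x. norm (f x) powr p)"
    by (intro continuous_on_powr' continuous_intros c) (use p in auto)
  have m: "(\<lambda>x. indicator K x *\<^sub>R (norm (f x) powr p)) \<in> borel_measurable borel"
    using \<open>compact K\<close> by (intro borel_measurable_scaleR borel_measurable_indicator borel_lebesgue_cont(1)[OF c'] borel_compact)
  have "integrable lborel (\<lambda>x. indicator K x *\<^sub>R (norm (f x) powr p))"
    by (intro borel_integrable_compact \<open>compact K\<close> continuous_on_subset[OF c']) auto
  then show "set_integrable lebesgue K (\<lambda>x. norm (f x) powr p)"
    unfolding set_integrable_def using m
    by (subst integrable_completion) auto
qed

lemma integrable_cont_support:
  fixes f :: "'a::euclidean_space \<Rightarrow> 'b::euclidean_space"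
  assumes c: "continuous_on UNIV f" and s: "\<And>x. norm x > r \<Longrightarrow> f x = 0"
  shows "integrable lebesgue f"
proof -
  obtain M where M: "0 \<le> M" "\<And>x. norm (f x) \<le> M * indicator (cball 0 r) x" "\<And>x. norm (f x) \<le> M"
    using cont_bounded_support[OF c s] by blast
  show ?thesis
    by (rule Bochner_Integration.integrable_bound[OF integrable_indicator_cball[of r M]])
       (use M borel_lebesgue_cont(2)[OF c] in \<open>auto simp: mult.commute[of _ M]\<close>)
qed

text \<open>Differentiation is along coordinate lines at parameter 0, the form in which
  \<open>smooth_fun\<close> speaks of test functions, so both fit into one product rule.\<close>

definition has_partial :: "'d::finite \<Rightarrow> (real^'d \<Rightarrow> 'b::real_normed_vector) \<Rightarrow> (real^'d \<Rightarrow> 'b) \<Rightarrow> bool" where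
  "has_partial i f g \<longleftrightarrow> (\<forall>x. ((\<lambda>t. f (x + t *\<^sub>R axis i 1)) has_vector_derivative g x) (at 0))"

text \<open>The derivative at 0 is given at every base point, so rebasing at
  \<open>x + s *\<^sub>R axis i 1\<close> yields it along the whole coordinate line.\<close>

lemma has_partialD:
  assumes "has_partial i f g"
  shows "((\<lambda>t. f (x + t *\<^sub>R axis i 1)) has_vector_derivative g (x + s *\<^sub>R axis i 1)) (at s)"
proof -
  have 1: "((\<lambda>t. f ((x + s *\<^sub>R axis i 1) + t *\<^sub>R axis i 1)) has_vector_derivative g (x + s *\<^sub>R axis i 1)) (at (s - s))"
    using assms by (simp add: has_partial_def)
  have "((\<lambda>t. t - s) has_vector_derivative 1) (at s)"
    by (auto intro!: derivative_eq_intros)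
  from vector_diff_chain_at[OF this 1] show ?thesis
    by (simp add: o_def algebra_simps)
qed

lemma has_partial_Lipschitz:
  fixes f :: "real^'d \<Rightarrow> 'b::real_normed_vector"
  assumes "has_partial i f g" and "\<And>x. norm (g x) \<le> M"
  shows "norm (f (x + t *\<^sub>R axis i 1) - f x) \<le> M * \<bar>t\<bar>"
proof -
  have "norm (f (x + t *\<^sub>R axis i 1) - f (x + 0 *\<^sub>R axis i 1)) \<le> M * norm (t - 0)"
  proof (rule differentiable_bound[of UNIV])
    show "((\<lambda>t. f (x + t *\<^sub>R axis i 1)) has_derivative (\<lambda>h. h *\<^sub>R g (x + s *\<^sub>R axis i 1))) (at s within UNIV)" for s
      using has_partialD[OF assms(1), of x s] by (simp add: has_vector_derivative_def)
    have "0 \<le> M" using assms(2)[of 0] norm_ge_zero order_trans by blast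
    then show "onorm (\<lambda>h. h *\<^sub>R g (x + s *\<^sub>R axis i 1)) \<le> M" for s
      by (intro onorm_bound)
         (use assms(2)[of "x + s *\<^sub>R axis i 1"] in \<open>auto simp: mult.commute[of M] intro!: mult_left_mono\<close>)
  qed auto
  then show ?thesis by simp
qed

text \<open>No Fubini is needed: the difference quotients have integral zero by translation invariance, and
  they converge dominatedly.\<close>
lemma integral_partial_zero:
  fixes f g :: "real^'d \<Rightarrow> 'b::euclidean_space"
  assumes fg: "has_partial i f g" and cf: "continuous_on UNIV f" and cg: "continuous_on UNIV g"
    and sf: "\<And>x. norm x > r \<Longrightarrow> f x = 0" and sg: "\<And>x. norm x > r \<Longrightarrow> g x = 0"
  shows "(\<integral>x. g x \<partial>lebesgue) = 0"
proof -
  obtain M where M: "\<And>x. norm (g x) \<le> M"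
    using cont_bounded_support[OF cg sg] by blast
  define e where "e = (axis i 1 :: real^'d)"
  \<comment> \<open>Step sizes at most 1 keep all difference quotients supported in the ball of
    radius \<open>r + 1\<close>; there the Lipschitz constant \<open>M\<close> dominates
    them.\<close>
  define t where "t n = inverse (real (Suc n))" for n
  define D where "D n x = (1 / t n) *\<^sub>R (f (x + t n *\<^sub>R e) - f x)" for n x
  have t: "0 < t n" "t n \<le> 1" for n by (auto simp: t_def field_simps)
  have ne: "norm e = 1" by (simp add: e_def)
  have cD: "continuous_on UNIV (D n)" for n
    unfolding D_def by (intro continuous_intros continuous_on_compose2[OF cf]) auto
  have int0: "(\<integral>x. D n x \<partial>lebesgue) = 0" for n
  proof -
    have i1: "integrable lborel f"
      using integrable_cont_support[OF cf sf] borel_lebesgue_cont[OF cf]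
      by (auto simp: integrable_completion)
    have i2: "integrable lborel (\<lambda>x. f (t n *\<^sub>R e + x))"
      using i1 borel_lebesgue_cont[OF cf]
      by (subst (asm) lborel_distr_plus[of "t n *\<^sub>R e", symmetric], subst (asm) integrable_distr_eq) auto
    have "(\<integral>x. f x \<partial>lborel) = (\<integral>x. f (t n *\<^sub>R e + x) \<partial>lborel)"
      using borel_lebesgue_cont[OF cf]
      by (subst lborel_distr_plus[of "t n *\<^sub>R e", symmetric], subst integral_distr) auto
    then have "(\<integral>x. D n x \<partial>lborel) = 0"
      using i1 i2 by (simp add: D_def add.commute)
    then show ?thesis
      using borel_lebesgue_cont[OF cD] by (subst integral_completion) auto
  qed
  have lim: "(\<lambda>n. \<integral>x. D n x \<partial>lebesgue) \<longlonglongrightarrow> (\<integral>x. g x \<partial>lebesgue)"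
  proof (rule integral_dominated_convergence[where w="\<lambda>x. indicator (cball (0::real^'d) (r+1)) x *\<^sub>R M"])
    show "integrable lebesgue (\<lambda>x. indicator (cball (0::real^'d) (r+1)) x *\<^sub>R M)"
      by (rule integrable_indicator_cball)
    show "AE x in lebesgue. (\<lambda>n. D n x) \<longlonglongrightarrow> g x"
    proof (rule AE_I2)
      fix x
      have "((\<lambda>s. (1/s) *\<^sub>R (f (x + s *\<^sub>R e) - f x)) \<longlongrightarrow> g x) (at 0)"
      proof (rule LIM_zero_cancel, rule tendsto_norm_zero_cancel, rule Lim_transform_eventually)
        show "((\<lambda>s. norm (f (x + s *\<^sub>R e) - f x - s *\<^sub>R g x) / norm s) \<longlongrightarrow> 0) (at 0)"
          using fg by (simp add: has_partial_def has_vector_derivative_def has_derivative_at e_def)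
        have "norm (f (x + s *\<^sub>R e) - f x - s *\<^sub>R g x) / norm s
            = norm ((1/s) *\<^sub>R (f (x + s *\<^sub>R e) - f x) - g x)" if "s \<noteq> 0" for s
        proof -
          have "(1/s) *\<^sub>R (f (x + s *\<^sub>R e) - f x) - g x = (1/s) *\<^sub>R (f (x + s *\<^sub>R e) - f x - s *\<^sub>R g x)"
            using that by (simp add: scaleR_right_diff_distrib)
          then show ?thesis by simp
        qed
        then show "\<forall>\<^sub>F s in at 0. norm (f (x + s *\<^sub>R e) - f x - s *\<^sub>R g x) / norm s
            = norm ((1/s) *\<^sub>R (f (x + s *\<^sub>R e) - f x) - g x)"
          by (auto simp: eventually_at_filter)
      qed
      moreover have "filterlim t (at 0) sequentially"
        unfolding filterlim_at t_def using LIMSEQ_inverse_real_of_nat by auto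
      ultimately show "(\<lambda>n. D n x) \<longlonglongrightarrow> g x"
        unfolding D_def by (rule filterlim_compose)
    qed
    show "AE x in lebesgue. norm (D n x) \<le> indicator (cball (0::real^'d) (r+1)) x *\<^sub>R M" for n
    proof (rule AE_I2)
      fix x
      show "norm (D n x) \<le> indicator (cball (0::real^'d) (r+1)) x *\<^sub>R M"
      proof (cases "norm x \<le> r + 1")
        case True
        then show ?thesis
          using has_partial_Lipschitz[OF fg M, of x "t n"] t[of n]
          by (simp add: D_def e_def pos_divide_le_eq del: scaleR_right_diff_distrib)
      next
        case False
        have "norm x \<le> norm (x + t n *\<^sub>R e) + norm (t n *\<^sub>R e)"
          using norm_triangle_ineq4[of "x + t n *\<^sub>R e" "t n *\<^sub>R e"] by simp
        then have "norm (x + t n *\<^sub>R e) > r"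
          using False t[of n] ne by simp
        then show ?thesis using False sf by (simp add: D_def)
      qed
    qed
  qed (use borel_lebesgue_cont[OF cD] borel_lebesgue_cont[OF cg] in auto)
  show ?thesis
    using LIMSEQ_unique[OF lim] int0 by simp
qed

text \<open>Integration by parts: the product rule turns the partial derivative of test function
  times \<open>f\<close> into two terms, and its integral vanishes by
  \<open>integral_partial_zero\<close>.\<close>

lemma weak_deriv_partial:
  fixes f g :: "('d::finite,'m::finite) vfun"
  assumes fg: "has_partial i f g" and cf: "continuous_on UNIV f" and cg: "continuous_on UNIV g"
  shows "weak_deriv i f g"
  unfolding weak_deriv_def
proof (intro allI impI)
  fix \<phi> :: "real^'d \<Rightarrow> real" assume "test_fun \<phi>"
  then obtain D K where D0: "D [] = \<phi>" and cD: "\<And>\<alpha>. continuous_on UNIV (D \<alpha>)"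
    and dD: "\<And>\<alpha> i x. ((\<lambda>t. D \<alpha> (x + t *\<^sub>R axis i 1)) has_real_derivative D (i # \<alpha>) x) (at 0)"
    and K: "compact K" "\<And>x. x \<notin> K \<Longrightarrow> \<phi> x = 0"
    unfolding test_fun_def smooth_fun_def by blast
  obtain r where r: "\<And>x. norm x > r \<Longrightarrow> \<phi> x = 0"
    using K compact_imp_bounded[OF K(1)] unfolding bounded_iff by (metis not_le)
  define \<psi> where "\<psi> = D [i]"
  have d\<phi>: "((\<lambda>t. \<phi> (x + t *\<^sub>R axis i 1)) has_real_derivative \<psi> x) (at 0)" for x
    using dD[of "[]" x i] by (simp add: D0 \<psi>_def)
  have c\<phi>: "continuous_on UNIV \<phi>" and c\<psi>: "continuous_on UNIV \<psi>"
    using cD[of "[]"] cD[of "[i]"] by (auto simp: D0 \<psi>_def)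
  have pd: "partial_deriv i \<phi> = \<psi>"
    unfolding partial_deriv_def by (rule ext) (rule DERIV_imp_deriv[OF d\<phi>])
  \<comment> \<open>The exterior of the ball is open, so near such a point the derivative is that of
    the zero function.\<close>
  have s\<psi>: "\<psi> x = 0" if "norm x > r" for x
  proof -
    have "open {t. norm (x + t *\<^sub>R (axis i 1 :: real^'d)) > r}"
      by (intro open_Collect_less continuous_intros)
    then have "((\<lambda>t. 0) has_real_derivative \<psi> x) (at 0)"
      by (rule has_field_derivative_transform_within_open[OF d\<phi>]) (use that r in auto)
    then show ?thesis using DERIV_unique[OF _ DERIV_const] by blast
  qed
  have hp: "has_partial i (\<lambda>x. \<phi> x *\<^sub>R f x) (\<lambda>x. \<psi> x *\<^sub>R f x + \<phi> x *\<^sub>R g x)"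
    unfolding has_partial_def
  proof
    fix x
    have "((\<lambda>t. f (x + t *\<^sub>R axis i 1)) has_vector_derivative g x) (at 0)"
      using fg by (simp add: has_partial_def)
    from has_vector_derivative_scaleR[OF d\<phi> this]
    show "((\<lambda>t. \<phi> (x + t *\<^sub>R axis i 1) *\<^sub>R f (x + t *\<^sub>R axis i 1)) has_vector_derivative \<psi> x *\<^sub>R f x + \<phi> x *\<^sub>R g x) (at 0)"
      by (simp add: add.commute)
  qed
  have "(\<integral>x. \<psi> x *\<^sub>R f x + \<phi> x *\<^sub>R g x \<partial>lebesgue) = 0"
    by (rule integral_partial_zero[OF hp, of r]) (auto intro!: continuous_intros cf cg c\<phi> c\<psi> simp: r s\<psi>)
  moreover have "integrable lebesgue (\<lambda>x. \<psi> x *\<^sub>R f x)" "integrable lebesgue (\<lambda>x. \<phi> x *\<^sub>R g x)"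
    by (rule integrable_cont_support[of _ r]; auto intro!: continuous_intros cf cg c\<phi> c\<psi> simp: r s\<psi>)+
  ultimately show "(\<integral>x. partial_deriv i \<phi> x *\<^sub>R f x \<partial>lebesgue) = - (\<integral>x. \<phi> x *\<^sub>R g x \<partial>lebesgue)"
    by (simp add: pd eq_neg_iff_add_eq_0)
qed

section \<open>Second-order calculus with partial derivatives\<close>

text \<open>The derivatives are carried as explicit data since they later serve as the weak
  derivatives in \<open>W2p_loc_derivs\<close>. The index order matches: \<open>H i j\<close>
  differentiates \<open>G i\<close> in direction \<open>j\<close>.\<close>

definition C2 :: "(real^'d::finite \<Rightarrow> 'b::real_normed_vector) \<Rightarrow> ('d \<Rightarrow> real^'d \<Rightarrow> 'b) \<Rightarrow> ('d \<Rightarrow> 'd \<Rightarrow> real^'d \<Rightarrow> 'b) \<Rightarrow> bool" where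
  "C2 u G H \<longleftrightarrow> continuous_on UNIV u \<and> (\<forall>i. continuous_on UNIV (G i) \<and> has_partial i u (G i)) \<and>
     (\<forall>i j. continuous_on UNIV (H i j) \<and> has_partial j (G i) (H i j))"

definition lap :: "('d::finite \<Rightarrow> 'd \<Rightarrow> real^'d \<Rightarrow> 'b::real_normed_vector) \<Rightarrow> real^'d \<Rightarrow> 'b" where
  "lap H x = (\<Sum>i\<in>UNIV. H i i x)"

definition drift :: "real^'d::finite^'d \<Rightarrow> ('d \<Rightarrow> real^'d \<Rightarrow> 'b::real_normed_vector) \<Rightarrow> real^'d \<Rightarrow> 'b" where
  "drift S G x = (\<Sum>i\<in>UNIV. (\<Sum>j\<in>UNIV. S$i$j * x$j) *\<^sub>R G i x)"

section \<open>Product, chain and scaling rules for partial derivatives\<close>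

lemma has_partial_const: "has_partial i (\<lambda>x. c) (\<lambda>x. 0)"
  by (simp add: has_partial_def)

lemma has_partial_add:
  assumes "has_partial i f f'" "has_partial i g g'"
  shows "has_partial i (\<lambda>x. f x + g x) (\<lambda>x. f' x + g' x)"
  using assms unfolding has_partial_def by (auto intro!: has_vector_derivative_add)

lemma has_partial_mult:
  fixes f g :: "real^'d::finite \<Rightarrow> 'b::real_normed_algebra"
  assumes "has_partial i f f'" "has_partial i g g'"
  shows "has_partial i (\<lambda>x. f x * g x) (\<lambda>x. f x * g' x + f' x * g x)"
  unfolding has_partial_def
proof
  fix x
  have "((\<lambda>t. f (x + t *\<^sub>R axis i 1)) has_vector_derivative f' x) (at 0)"
       "((\<lambda>t. g (x + t *\<^sub>R axis i 1)) has_vector_derivative g' x) (at 0)"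
    using assms by (auto simp: has_partial_def)
  from has_vector_derivative_mult[OF this]
  show "((\<lambda>t. f (x + t *\<^sub>R axis i 1) * g (x + t *\<^sub>R axis i 1)) has_vector_derivative (f x * g' x + f' x * g x)) (at 0)"
    by simp
qed

lemma has_partial_scaleR:
  fixes g :: "real^'d::finite \<Rightarrow> 'b::real_normed_vector"
  assumes "has_partial i f f'" "has_partial i g g'"
  shows "has_partial i (\<lambda>x. f x *\<^sub>R g x) (\<lambda>x. f x *\<^sub>R g' x + f' x *\<^sub>R g x)"
  unfolding has_partial_def
proof
  fix x
  have "((\<lambda>t. f (x + t *\<^sub>R axis i 1)) has_field_derivative f' x) (at 0)"
       "((\<lambda>t. g (x + t *\<^sub>R axis i 1)) has_vector_derivative g' x) (at 0)"
    using assms by (auto simp: has_partial_def has_real_derivative_iff_has_vector_derivative)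
  from has_vector_derivative_scaleR[OF this]
  show "((\<lambda>t. f (x + t *\<^sub>R axis i 1) *\<^sub>R g (x + t *\<^sub>R axis i 1)) has_vector_derivative (f x *\<^sub>R g' x + f' x *\<^sub>R g x)) (at 0)"
    by simp
qed

lemma has_partial_bounded_linear:
  assumes "bounded_linear L" "has_partial i f f'"
  shows "has_partial i (\<lambda>x. L (f x)) (\<lambda>x. L (f' x))"
  using assms bounded_linear.has_vector_derivative[OF assms(1)] unfolding has_partial_def by blast

lemma has_partial_component:
  "has_partial i (\<lambda>x::real^'d::finite. x $ j) (\<lambda>x. if i = j then 1 else 0)"
  unfolding has_partial_def
proof
  fix x
  have "((\<lambda>t. x $ j + t * (axis i 1 :: real^'d) $ j) has_real_derivative (axis i 1 :: real^'d) $ j) (at 0)"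
    by (auto intro!: derivative_eq_intros)
  then show "((\<lambda>t. (x + t *\<^sub>R axis i 1) $ j) has_vector_derivative (if i = j then 1 else 0)) (at 0)"
    by (simp add: has_real_derivative_iff_has_vector_derivative axis_def eq_commute)
qed

text \<open>Along a coordinate line the squared radius is the polynomial
  \<open>x \<bullet> x + 2 t x_i + t^2\<close>. Using the squared radius instead of the radius
  avoids a singularity at the origin.\<close>

lemma has_partial_radial:
  fixes F :: "real \<Rightarrow> 'b::real_normed_vector"
  assumes "\<And>s. (F has_vector_derivative F' s) (at s)"
  shows "has_partial i (\<lambda>x::real^'d::finite. F (x \<bullet> x)) (\<lambda>x. (2 * x $ i) *\<^sub>R F' (x \<bullet> x))"
  unfolding has_partial_def
proof
  fix x
  let ?e = "axis i 1 :: real^'d"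
  have "((\<lambda>t. x \<bullet> x + 2 * t * (x $ i) + t^2) has_vector_derivative 2 * x $ i) (at 0)"
    unfolding has_real_derivative_iff_has_vector_derivative[symmetric]
    by (auto intro!: derivative_eq_intros)
  moreover have "(x + t *\<^sub>R ?e) \<bullet> (x + t *\<^sub>R ?e) = x \<bullet> x + 2 * t * (x $ i) + t^2" for t
    by (simp add: inner_add_left inner_add_right inner_axis inner_axis' power2_eq_square algebra_simps)
  ultimately have 1: "((\<lambda>t. (x + t *\<^sub>R ?e) \<bullet> (x + t *\<^sub>R ?e)) has_vector_derivative 2 * x $ i) (at 0)"
    by simp
  have 2: "(F has_vector_derivative F' (x \<bullet> x)) (at ((x + 0 *\<^sub>R ?e) \<bullet> (x + 0 *\<^sub>R ?e)))"
    using assms by simp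
  from vector_diff_chain_at[OF 1 2]
  show "((\<lambda>t. F ((x + t *\<^sub>R ?e) \<bullet> (x + t *\<^sub>R ?e))) has_vector_derivative (2 * x $ i) *\<^sub>R F' (x \<bullet> x)) (at 0)"
    by (simp add: o_def)
qed

lemma has_partial_dilation:
  assumes "has_partial i f f'"
  shows "has_partial i (\<lambda>x. f (c *\<^sub>R x)) (\<lambda>x. c *\<^sub>R f' (c *\<^sub>R x))"
  unfolding has_partial_def
proof
  fix x
  have 1: "((\<lambda>t. c * t) has_vector_derivative c) (at 0)"
    unfolding has_real_derivative_iff_has_vector_derivative[symmetric]
    by (auto intro!: derivative_eq_intros)
  have "((\<lambda>t. f (c *\<^sub>R x + t *\<^sub>R axis i 1)) has_vector_derivative f' (c *\<^sub>R x)) (at (c * 0))"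
    using assms by (simp add: has_partial_def)
  from vector_diff_chain_at[OF 1 this]
  show "((\<lambda>t. f (c *\<^sub>R (x + t *\<^sub>R axis i 1))) has_vector_derivative c *\<^sub>R f' (c *\<^sub>R x)) (at 0)"
    by (simp add: o_def scaleR_add_right)
qed

lemma has_partial_zero_outside:
  fixes f :: "real^'d \<Rightarrow> 'b::real_normed_vector"
  assumes fg: "has_partial i f g" and sf: "\<And>x. norm x > r \<Longrightarrow> f x = 0" and x: "norm x > r"
  shows "g x = 0"
proof -
  have o: "open {t. norm (x + t *\<^sub>R (axis i 1 :: real^'d)) > r}"
    by (intro open_Collect_less continuous_intros)
  have "((\<lambda>t. f (x + t *\<^sub>R axis i 1)) has_vector_derivative g x) (at 0)"
    using fg by (simp add: has_partial_def)
  then have "((\<lambda>t. 0) has_vector_derivative g x) (at 0)"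
    by (rule has_vector_derivative_transform_within_open[OF _ o]) (use x sf in auto)
  then show ?thesis
    using vector_derivative_unique_at[OF _ has_vector_derivative_const] by blast
qed

section \<open>Support and closure properties of \<open>C2\<close>\<close>

lemma C2_zero_outside:
  assumes "C2 u G H" and "\<And>x. norm x > r \<Longrightarrow> u x = 0" and "norm x > r"
  shows "G i x = 0" "H i j x = 0"
proof -
  have G: "G i x = 0" if "norm x > r" for i x
    using has_partial_zero_outside[of i u "G i" r x] assms(1,2) that by (auto simp: C2_def)
  then show "G i x = 0" "H i j x = 0"
    using has_partial_zero_outside[of j "G i" "H i j" r x] assms(1,3) by (auto simp: C2_def)
qed

lemma C2_mult:
  fixes u v :: "real^'d::finite \<Rightarrow> 'b::real_normed_algebra"
  assumes "C2 u G H" "C2 v G' H'"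
  shows "C2 (\<lambda>x. u x * v x) (\<lambda>i x. u x * G' i x + G i x * v x)
     (\<lambda>i j x. (u x * H' i j x + G j x * G' i x) + (G i x * G' j x + H i j x * v x))"
  using assms unfolding C2_def
  by (intro conjI allI continuous_intros has_partial_add has_partial_mult) auto

lemma C2_linear_form:
  "C2 (\<lambda>x::real^'d::finite. \<Sum>j\<in>UNIV. z $ j * complex_of_real (x $ j)) (\<lambda>i x. z $ i) (\<lambda>i j x. 0)"
  unfolding C2_def
proof (intro conjI allI has_partial_const continuous_intros)
  fix i :: 'd
  show "has_partial i (\<lambda>x. \<Sum>j\<in>UNIV. z $ j * complex_of_real (x $ j)) (\<lambda>x. z $ i)"
    unfolding has_partial_def
  proof
    fix x
    have "((\<lambda>t. (\<Sum>j\<in>UNIV. z $ j * complex_of_real (x $ j)) + of_real t * z $ i) has_vector_derivative z $ i) (at 0)"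
      by (auto intro!: derivative_eq_intros)
    moreover have "(\<Sum>j\<in>UNIV. z $ j * complex_of_real ((x + t *\<^sub>R axis i 1) $ j)) =
        (\<Sum>j\<in>UNIV. z $ j * complex_of_real (x $ j)) + of_real t * z $ i" for t
    proof -
      have "z $ j * complex_of_real ((x + t *\<^sub>R axis i 1) $ j) = 
         z $ j * complex_of_real (x $ j) + (if j = i then of_real t * z $ i else 0)" for j
        by (simp add: axis_def algebra_simps)
      then show ?thesis by (simp add: sum.distrib)
    qed
    ultimately show "((\<lambda>t. \<Sum>j\<in>UNIV. z $ j * complex_of_real ((x + t *\<^sub>R axis i 1) $ j)) has_vector_derivative z $ i) (at 0)"
      by simp
  qed
qed

lemma C2_radial:
  assumes F: "\<And>s. (F has_vector_derivative F' s) (at s)" and F': "\<And>s. (F' has_vector_derivative F'' s) (at s)"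
    and F'': "continuous_on UNIV F''"
  shows "C2 (\<lambda>x::real^'d::finite. F (x \<bullet> x)) (\<lambda>i x. (2 * x $ i) *\<^sub>R F' (x \<bullet> x))
     (\<lambda>i j x. (2 * x $ i) *\<^sub>R ((2 * x $ j) *\<^sub>R F'' (x \<bullet> x)) + (if j = i then 2 else 0) *\<^sub>R F' (x \<bullet> x))"
proof -
  have cF: "continuous_on UNIV F" "continuous_on UNIV F'"
    using F F' by (auto intro!: continuous_at_imp_continuous_on has_vector_derivative_continuous)
  then have c: "continuous_on UNIV (\<lambda>x::real^'d. F (x \<bullet> x))" "continuous_on UNIV (\<lambda>x::real^'d. F' (x \<bullet> x))" 
     "continuous_on UNIV (\<lambda>x::real^'d. F'' (x \<bullet> x))"
    using continuous_on_compose2[OF cF(1), of UNIV "\<lambda>x. x \<bullet> x"] continuous_on_compose2[OF cF(2), of UNIV "\<lambda>x. x \<bullet> x"]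
      continuous_on_compose2[OF F'', of UNIV "\<lambda>x. x \<bullet> x"] by (simp_all add: continuous_on_inner continuous_on_id)
  have h: "has_partial j (\<lambda>x::real^'d. 2 * x $ i) (\<lambda>x. if j = i then 2 else 0)" for i j
    using has_partial_mult[OF has_partial_const[of j "2::real"] has_partial_component[of j i]]
    by (cases "j = i") simp_all
  show ?thesis
    unfolding C2_def
    by (intro conjI allI continuous_intros c has_partial_radial[OF F] has_partial_scaleR[OF h] has_partial_radial[OF F'])
qed

lemma C2_dilation:
  fixes u :: "real^'d::finite \<Rightarrow> 'b::real_normed_vector"
  assumes "C2 u G H"
  shows "C2 (\<lambda>x. u (c *\<^sub>R x)) (\<lambda>i x. c *\<^sub>R G i (c *\<^sub>R x)) (\<lambda>i j x. c *\<^sub>R (c *\<^sub>R H i j (c *\<^sub>R x)))"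
proof -
  have c: "continuous_on UNIV (\<lambda>x. f (c *\<^sub>R x))" if "continuous_on UNIV f" for f :: "real^'d \<Rightarrow> 'b"
    by (rule continuous_on_compose2[OF that]) (auto intro!: continuous_intros)
  show ?thesis
    using assms unfolding C2_def
    by (intro conjI allI continuous_intros c has_partial_dilation
        has_partial_bounded_linear[OF bounded_linear_scaleR_right]) auto
qed

lemma C2_bounded_linear:
  assumes "bounded_linear L" "C2 u G H"
  shows "C2 (\<lambda>x. L (u x)) (\<lambda>i x. L (G i x)) (\<lambda>i j x. L (H i j x))"
  using assms(2) unfolding C2_def
  by (intro conjI allI has_partial_bounded_linear[OF assms(1)] bounded_linear.continuous_on[OF assms(1)]) auto

lemma W2p_loc_derivs_C2:
  fixes v :: "('d::finite,'m::finite) vfun"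
  assumes "0 < p" "C2 v G H"
  shows "W2p_loc_derivs p v G H"
  using assms unfolding W2p_loc_derivs_def C2_def
  by (auto intro!: Lp_loc_cont weak_deriv_partial)

text \<open>The gradient of a radial function is parallel to \<open>x\<close>, and the quadratic
  form of a skew matrix vanishes.\<close>

lemma drift_radial:
  fixes S :: "real^'d::finite^'d" and f :: "real^'d \<Rightarrow> 'b::real_normed_vector"
  assumes "transpose S = - S"
  shows "drift S (\<lambda>i x. (c * x $ i) *\<^sub>R f x) x = 0"
proof -
  have S: "S $ j $ i = - S $ i $ j" for i j
    using arg_cong[OF assms, of "\<lambda>M. M $ i $ j"] by (simp add: transpose_def)
  let ?q = "\<Sum>i\<in>UNIV. (\<Sum>j\<in>UNIV. S$i$j * x$j) * x $ i"
  have "?q = (\<Sum>i\<in>UNIV. \<Sum>j\<in>UNIV. S$i$j * x$j * x$i)"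
    by (simp add: sum_distrib_right)
  also have "\<dots> = (\<Sum>i\<in>UNIV. \<Sum>j\<in>UNIV. S$j$i * x$i * x$j)"
    by (rule sum.swap)
  also have "\<dots> = - (\<Sum>i\<in>UNIV. \<Sum>j\<in>UNIV. S$i$j * x$j * x$i)"
    by (subst S) (simp add: sum_negf mult_ac)
  also have "\<dots> = - ?q"
    by (simp add: sum_distrib_right)
  finally have "?q = 0" by simp
  moreover have "drift S (\<lambda>i x. (c * x $ i) *\<^sub>R f x) x = (c * ?q) *\<^sub>R f x"
    unfolding drift_def sum_distrib_left[of c] scaleR_sum_left scaleR_scaleR
    by (intro sum.cong) (simp_all add: mult_ac)
  ultimately show ?thesis by simp
qed

text \<open>Leibniz rule for a first-order operator; it makes drift eigenvalues add under
  multiplication of eigenfunctions.\<close>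

lemma drift_mult:
  fixes u v :: "real^'d::finite \<Rightarrow> 'b::real_normed_algebra"
  shows "drift S (\<lambda>i x. u x * G' i x + G i x * v x) x = u x * drift S G' x + drift S G x * v x"
  unfolding drift_def sum_distrib_left[of "u x"] sum_distrib_right[of _ _ "v x"] sum.distrib[symmetric]
  by (simp add: scaleR_add_right)

text \<open>The field \<open>Sx\<close> is linear, so the chain-rule factor \<open>c\<close> is
  absorbed by the coefficients. Drift eigenvalues thus survive dilation, while the Laplacian picks
  up \<open>c^2\<close>.\<close>

lemma drift_dilation:
  shows "drift S (\<lambda>i x. c *\<^sub>R G i (c *\<^sub>R x)) x = drift S G (c *\<^sub>R x)"
proof -
  have "(\<Sum>j\<in>UNIV. S$i$j * (c *\<^sub>R x)$j) = (\<Sum>j\<in>UNIV. S$i$j * x$j) * c" for i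
    unfolding sum_distrib_right by (simp add: mult_ac)
  then show ?thesis by (simp add: drift_def)
qed

section \<open>Shell modes\<close>

lemma exp_has_vector_derivative:
  "((\<lambda>s. c * exp (z * complex_of_real s)) has_vector_derivative (c * z) * exp (z * complex_of_real s)) (at s)"
proof -
  have "((\<lambda>w. c * exp (z * w)) has_field_derivative (c * z) * exp (z * complex_of_real s)) (at (complex_of_real s))"
    by (auto intro!: derivative_eq_intros)
  then show ?thesis by (rule has_vector_derivative_real_field)
qed

text \<open>The phase \<open>exp (i \<kappa> |x|\<^sup>2 / (2R))\<close> has gradient of modulus \<open>\<kappa> |x| / R\<close>, which is nearly \<open>\<kappa>\<close> on a thin
  shell \<open>|x| \<approx> R\<close>; being radial, it is annihilated by the drift.\<close>
lemma shell_mode: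
  fixes g :: "real^'d::finite \<Rightarrow> complex" and S :: "real^'d^'d"
  assumes skew: "transpose S = - S" and g: "C2 g G H" and dr: "\<And>x. drift S G x = \<mu> * g x"
    and sh: "\<And>y. g y \<noteq> 0 \<Longrightarrow> \<bar>y \<bullet> y - 1\<bar> \<le> \<delta>" and R: "1 \<le> R" and \<kappa>: "0 \<le> \<kappa>"
  shows "\<exists>u Gu Hu. C2 u Gu Hu \<and> (\<forall>x. norm (u x) = norm (g ((1/R) *\<^sub>R x))) \<and>
     (\<forall>x. drift S Gu x = \<mu> * u x) \<and>
     (\<forall>x. norm (lap Hu x + complex_of_real (\<kappa>^2) * u x) \<le> \<kappa>^2 * \<delta> * norm (g ((1/R) *\<^sub>R x)) +
        (\<kappa> * CARD('d) * norm (g ((1/R) *\<^sub>R x)) +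
          2 * \<kappa> * norm (\<Sum>i\<in>UNIV. ((1/R) *\<^sub>R x) $ i *\<^sub>R G i ((1/R) *\<^sub>R x)) + norm (lap H ((1/R) *\<^sub>R x))) / R)"
proof -
  \<comment> \<open>A purely imaginary exponent, so the phase factor \<open>E\<close> has modulus
    one and \<open>u\<close> has the modulus of the dilated \<open>g\<close>.\<close>
  define z where "z = \<i> * complex_of_real (\<kappa> / (2 * R))"
  define F where "F s = exp (z * complex_of_real s)" for s
  have F: "(F has_vector_derivative z * F s) (at s)" for s
    unfolding F_def using exp_has_vector_derivative[of 1 z s] by simp
  have F': "((\<lambda>s. z * F s) has_vector_derivative (z * z) * F s) (at s)" for s
    unfolding F_def by (rule exp_has_vector_derivative)
  have cF: "continuous_on UNIV (\<lambda>s. (z * z) * F s)"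
    unfolding F_def by (intro continuous_intros)
  define E where "E x = F (x \<bullet> x)" for x :: "real^'d"
  define GE where "GE i x = (2 * x $ i) *\<^sub>R (z * E x)" for i and x :: "real^'d"
  define HE where "HE i j x = (2 * x $ i) *\<^sub>R ((2 * x $ j) *\<^sub>R ((z * z) * E x)) + (if j = i then 2 else 0) *\<^sub>R (z * E x)"
    for i j and x :: "real^'d"
  have E: "C2 E GE HE"
    using C2_radial[OF F F' cF] unfolding E_def GE_def HE_def .
  have nE: "norm (E x) = 1" for x
    by (simp add: E_def F_def z_def mult.assoc flip: of_real_mult)
  define y where "y x = (1/R) *\<^sub>R x" for x :: "real^'d"
  define g' where "g' x = g (y x)" for x
  define G' where "G' i x = (1/R) *\<^sub>R G i (y x)" for i x
  define H' where "H' i j x = (1/R) *\<^sub>R ((1/R) *\<^sub>R H i j (y x))" for i j x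
  have g': "C2 g' G' H'"
    using C2_dilation[OF g, of "1/R"] unfolding g'_def G'_def H'_def y_def .
  define u where "u x = g' x * E x" for x
  define Gu where "Gu i x = g' x * GE i x + G' i x * E x" for i x
  define Hu where "Hu i j x = (g' x * HE i j x + G' j x * GE i x) + (G' i x * GE j x + H' i j x * E x)" for i j x
  have u: "C2 u Gu Hu"
    using C2_mult[OF g' E] unfolding u_def Gu_def Hu_def .
  have nu: "norm (u x) = norm (g ((1/R) *\<^sub>R x))" for x
    by (simp add: u_def norm_mult nE g'_def y_def)
  have du: "drift S Gu x = \<mu> * u x" for x
  proof -
    have "drift S GE x = 0"
      unfolding GE_def by (rule drift_radial[OF skew])
    moreover have "drift S G' x = \<mu> * g' x"
      unfolding G'_def y_def drift_dilation g'_def by (rule dr)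
    ultimately show ?thesis
      unfolding Gu_def drift_mult u_def by simp
  qed
  have lu: "norm (lap Hu x + complex_of_real (\<kappa>^2) * u x) \<le> \<kappa>^2 * \<delta> * norm (g (y x)) +
        (\<kappa> * CARD('d) * norm (g (y x)) + 2 * \<kappa> * norm (\<Sum>i\<in>UNIV. y x $ i *\<^sub>R G i (y x)) + norm (lap H (y x))) / R" for x
  proof -
    define T where "T = (\<Sum>i\<in>UNIV. y x $ i *\<^sub>R G i (y x))"
    have R0: "R \<noteq> 0" "0 < R" using R by auto
    have xi: "x $ i = R * y x $ i" for i using R0 by (simp add: y_def)
    \<comment> \<open>In the rescaled variable the four terms are the squared phase gradient, the
      second derivative of the phase, the cross term and the second derivative of
      \<open>g\<close>.\<close>
    have Hii: "Hu i i x = E x * (complex_of_real (4 * R^2 * (y x $ i * y x $ i)) * (z * z) * g (y x)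
         + 2 * z * g (y x) + 4 * z * (y x $ i *\<^sub>R G i (y x)) + of_real (1/R^2) * H i i (y x))" for i
      using R0 unfolding Hu_def g'_def GE_def HE_def G'_def H'_def
      by (simp add: scaleR_conv_of_real xi power2_eq_square field_simps)
    have "lap Hu x = E x * (of_real (4 * R^2 * (y x \<bullet> y x)) * (z * z) * g (y x)
         + of_nat CARD('d) * (2 * z * g (y x)) + 4 * z * T + of_real (1/R^2) * lap H (y x))"
    proof -
      have "(\<Sum>i\<in>UNIV. E x * (complex_of_real (a * q i) * b * c + e + k * t i + l * h i))
          = E x * (complex_of_real (a * (\<Sum>i\<in>UNIV. q i)) * b * c + of_nat CARD('d) * e + k * (\<Sum>i\<in>UNIV. t i) + l * (\<Sum>i\<in>UNIV. h i))"
        for a b c e k l and q :: "'d \<Rightarrow> real" and t h :: "'d \<Rightarrow> complex"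
        unfolding of_real_mult of_real_sum sum_distrib_left[symmetric] sum.distrib sum_distrib_right[symmetric] by simp
      then show ?thesis
        unfolding lap_def Hii by (simp only: inner_vec_def inner_real_def T_def)
    qed
    \<comment> \<open>The leading term does not decay in \<open>R\<close>, but on the shell it
      differs from \<open>- \<kappa>^2\<close> by at most \<open>\<kappa>^2 * \<delta>\<close>. The
      other terms contain \<open>z\<close>, of modulus \<open>\<kappa> / (2 * R)\<close>, or
      \<open>1 / R^2\<close>, which is at most \<open>1 / R\<close>.\<close>
    moreover have Z: "of_real (4 * R^2 * (y x \<bullet> y x)) * (z * z) = - complex_of_real (\<kappa>^2 * (y x \<bullet> y x))"
      using R0 by (simp add: z_def power2_eq_square field_simps)
    ultimately have "lap Hu x + complex_of_real (\<kappa>^2) * u x = E x * (complex_of_real (\<kappa>^2 * (1 - y x \<bullet> y x)) * g (y x)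
         + (of_nat CARD('d) * (2 * z * g (y x)) + 4 * z * T + of_real (1/R^2) * lap H (y x)))"
      unfolding Z by (simp add: u_def g'_def algebra_simps)
    then have "norm (lap Hu x + complex_of_real (\<kappa>^2) * u x) = norm (complex_of_real (\<kappa>^2 * (1 - y x \<bullet> y x)) * g (y x)
         + (of_nat CARD('d) * (2 * z * g (y x)) + 4 * z * T + of_real (1/R^2) * lap H (y x)))"
      by (simp only: norm_mult nE mult_1)
    also have "\<dots> \<le> norm (complex_of_real (\<kappa>^2 * (1 - y x \<bullet> y x)) * g (y x))
         + (norm (of_nat CARD('d) * (2 * z * g (y x))) + norm (4 * z * T) + norm (of_real (1/R^2) * lap H (y x)))"
      by (intro order_trans[OF norm_triangle_ineq] add_mono order_refl)
    also have "norm (complex_of_real (\<kappa>^2 * (1 - y x \<bullet> y x)) * g (y x)) \<le> \<kappa>^2 * \<delta> * norm (g (y x))"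
    proof (cases "g (y x) = 0")
      case False
      then have "\<bar>1 - y x \<bullet> y x\<bar> \<le> \<delta>" using sh[of "y x"] by simp
      then show ?thesis
        unfolding norm_mult norm_of_real abs_mult by (intro mult_right_mono mult_mono) auto
    qed simp
    also have "norm (of_real (1/R^2) * lap H (y x)) \<le> norm (lap H (y x)) / R"
    proof -
      have "1 / R^2 \<le> 1 / R" using R by (simp add: power2_eq_square field_simps)
      then have "(1 / R^2) * norm (lap H (y x)) \<le> (1 / R) * norm (lap H (y x))"
        by (rule mult_right_mono) simp
      then show ?thesis by (simp only: norm_mult norm_of_real) simp
    qed
    also have "norm (of_nat CARD('d) * (2 * z * g (y x))) = \<kappa> * CARD('d) * norm (g (y x)) / R"
      using R0 \<kappa> by (simp add: norm_mult z_def norm_divide)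
    also have "norm (4 * z * T) = 2 * \<kappa> * norm T / R"
      using R0 \<kappa> by (simp add: norm_mult z_def norm_divide)
    finally show ?thesis
      by (simp add: T_def add_divide_distrib)
  qed
  show ?thesis
    using u nu du lu unfolding y_def by blast
qed

text \<open>The factor \<open>R ^ CARD('d)\<close> will occur on both sides of the resolvent
  estimate and cancel, so \<open>R\<close> can be taken large freely.\<close>

lemma integral_dilation:
  fixes f :: "real^'d::finite \<Rightarrow> real"
  assumes f: "continuous_on UNIV f" and R: "0 < R"
  shows "(\<integral>x. f ((1/R) *\<^sub>R x) \<partial>lebesgue) = R ^ CARD('d) * (\<integral>x. f x \<partial>lebesgue)"
proof -
  have c: "continuous_on UNIV (\<lambda>x. f ((1/R) *\<^sub>R x))"
    by (rule continuous_on_compose2[OF f]) (auto intro!: continuous_intros)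
  have b: "f \<in> borel_measurable borel" "(\<lambda>x. f ((1/R) *\<^sub>R x)) \<in> borel_measurable borel"
    using f c by (simp_all add: borel_measurable_continuous_onI)
  have "(\<integral>x. f ((1/R) *\<^sub>R x) \<partial>lborel) =
      (\<integral>x. f ((1/R) *\<^sub>R x) \<partial>(density (distr lborel borel (\<lambda>x. 0 + R *\<^sub>R x)) (\<lambda>_. ennreal (\<bar>R\<bar>^DIM(real^'d)))))"
    using R by (subst lborel_affine[of R 0]) auto
  also have "\<dots> = (\<integral>x. R ^ CARD('d) * f ((1/R) *\<^sub>R (R *\<^sub>R x)) \<partial>lborel)"
    using R b by (subst integral_density) (auto simp: integral_distr)
  also have "\<dots> = R ^ CARD('d) * (\<integral>x. f x \<partial>lborel)"
    using R by simp
  finally show ?thesis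
    using b by (simp add: integral_completion)
qed

section \<open>The operator on \<open>C2\<close> functions with bounded support\<close>

lemma bounded_bilinear_matrix_vector:
  "bounded_bilinear (\<lambda>(M::complex^'m^'m) x. M *v x)"
  unfolding bilinear_conv_bounded_bilinear[symmetric] bilinear_def
  by (auto intro!: linearI simp: vec_eq_iff matrix_vector_mult_def sum.distrib algebra_simps scaleR_sum_right)

lemma bounded_linear_matrix_vector: "bounded_linear (\<lambda>x. (M::complex^'m^'m) *v x)"
  by (rule bounded_bilinear.bounded_linear_right[OF bounded_bilinear_matrix_vector])

text \<open>Admits the modes to the domain. The differential part is continuous with bounded
  support; the term with \<open>Q\<close> is only measurable, so the whole image is handled by an
  almost everywhere bound.\<close>

lemma LQ_C2:
  fixes v :: "('d::finite,'m::finite) vfun"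
  assumes p: "0 < p" and v: "C2 v G H" and s: "\<And>x. norm x > r \<Longrightarrow> v x = 0"
    and Qm: "Q \<in> borel_measurable lebesgue" and Qb: "AE x in lebesgue. norm (Q x) \<le> M"
  shows "LQ p A S B Q v (\<lambda>x. (A *v lap H x + drift S G x) - B *v v x + Q x *v v x)" (is "LQ _ _ _ _ _ _ ?w")
proof -
  have OU: "OU_expr A S G H = (\<lambda>x. A *v lap H x + drift S G x)"
    by (simp add: OU_expr_def lap_def drift_def fun_eq_iff)
  have cG: "continuous_on UNIV (G i)" and cH: "continuous_on UNIV (H i j)" and cv: "continuous_on UNIV v" for i j
    using v by (auto simp: C2_def)
  have cM: "continuous_on UNIV (\<lambda>x. M *v f x)" if "continuous_on UNIV f" for M :: "complex^'m^'m" and f :: "('d,'m) vfun"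
    by (rule bounded_linear.continuous_on[OF bounded_linear_matrix_vector that])
  have cOU: "continuous_on UNIV (OU_expr A S G H)"
    unfolding OU lap_def drift_def by (intro continuous_intros cM cG cH)
  have sOU: "OU_expr A S G H x = 0" if "norm x > r" for x
    using C2_zero_outside[OF v s that] by (simp add: OU lap_def drift_def)
  have LOU: "Lp p (OU_expr A S G H)"
    by (rule Lp_cont[OF p cOU sOU])
  have c1: "continuous_on UNIV (\<lambda>x. OU_expr A S G H x - B *v v x)"
    by (intro continuous_intros cM cOU cv)
  obtain M1 where M1: "\<And>x. norm (OU_expr A S G H x - B *v v x) \<le> M1 * indicator (cball 0 r) x"
    using cont_bounded_support[OF c1, of r] sOU s by auto
  obtain M2 where M2: "0 \<le> M2" "\<And>x. norm (v x) \<le> M2 * indicator (cball 0 r) x"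
    using cont_bounded_support[OF cv s] by blast
  obtain K where K: "0 < K" "\<And>(N::complex^'m^'m) x. norm (N *v x) \<le> norm N * norm x * K"
    using bounded_bilinear.pos_bounded[OF bounded_bilinear_matrix_vector] by blast
  have m: "?w \<in> borel_measurable lebesgue"
  proof -
    have "(\<lambda>x. Q x *v v x) \<in> borel_measurable lebesgue"
      using bounded_bilinear.continuous_on[OF bounded_bilinear_matrix_vector continuous_on_fst continuous_on_snd]
      by (intro borel_measurable_continuous_Pair[OF Qm borel_lebesgue_cont(2)[OF cv]]) (auto intro: continuous_on_id)
    then show ?thesis
      using borel_lebesgue_cont(2)[OF c1] unfolding OU by (intro borel_measurable_add)
  qed
  have Lw: "Lp p ?w"
  proof (rule Lp_bounded_support[OF p m])
    show "AE x in lebesgue. norm (?w x) \<le> (M1 + M * M2 * K) * indicator (cball 0 r) x"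
      using Qb
    proof eventually_elim
      case (elim x)
      have "norm (?w x) \<le> norm (OU_expr A S G H x - B *v v x) + norm (Q x *v v x)"
        unfolding OU by (rule norm_triangle_ineq)
      also have "\<dots> \<le> M1 * indicator (cball 0 r) x + M * (M2 * indicator (cball 0 r) x) * K"
        using K(1) M2 elim order_trans[OF norm_ge_zero elim]
        by (intro add_mono M1 order_trans[OF K(2)] mult_right_mono mult_mono) auto
      finally show ?case by (simp add: algebra_simps)
    qed
  qed
  have "v \<in> dom_L0 p A S"
    unfolding dom_L0_def using W2p_loc_derivs_C2[OF p v] LOU Lp_cont[OF p cv s] by blast
  then show "LQ p A S B Q v ?w"
    unfolding LQ_def using Lw W2p_loc_derivs_C2[OF p v]
    by (intro conjI exI[of _ G] exI[of _ H]) (simp_all add: OU)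
qed

section \<open>Eigenfunctions of the drift\<close>

lemma det_zero_kernel:
  fixes M :: "'a::field^'n^'n"
  assumes "det M = 0"
  obtains x where "x \<noteq> 0" "M *v x = 0"
proof -
  have "\<not> (\<exists>N. N ** M = mat 1)"
    using assms invertible_left_inverse[of M] invertible_det_nz[of M] by blast
  then show thesis
    using that unfolding matrix_left_invertible_ker by blast
qed

text \<open>Away from 0 the function agrees locally with zero or a monomial. At 0 the exponent of at
  least two makes the difference quotient \<open>max 0 h ^ Suc n\<close>, which tends to 0.\<close>

lemma max_power_has_derivative:
  "((\<lambda>t. max 0 t ^ Suc (Suc n)) has_real_derivative real (Suc (Suc n)) * max 0 t ^ Suc n) (at (t::real))"
proof (cases t "0::real" rule: linorder_cases)
  case less
  have "((\<lambda>t. 0) has_real_derivative 0) (at t)" by simp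
  then have "((\<lambda>t. max 0 t ^ Suc (Suc n)) has_real_derivative 0) (at t)"
    by (rule has_field_derivative_transform_within_open[of _ _ _ "{..<0}"]) (use less in auto)
  then show ?thesis using less by simp
next
  case greater
  have "((\<lambda>t. t ^ Suc (Suc n)) has_real_derivative real (Suc (Suc n)) * t ^ Suc n) (at t)"
    using DERIV_pow[of "Suc (Suc n)" t] by simp
  then have "((\<lambda>t. max 0 t ^ Suc (Suc n)) has_real_derivative real (Suc (Suc n)) * t ^ Suc n) (at t)"
    by (rule has_field_derivative_transform_within_open[of _ _ _ "{0<..}"]) (use greater in auto)
  then show ?thesis using greater by simp
next
  case equal
  have "((\<lambda>h::real. max 0 h ^ Suc n) \<longlongrightarrow> max 0 0 ^ Suc n) (at 0)"
    by (intro tendsto_intros)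
  then have "((\<lambda>h::real. max 0 h ^ Suc n) \<longlongrightarrow> 0) (at 0)" by simp
  then have "((\<lambda>h::real. (max 0 (0 + h) ^ Suc (Suc n) - max 0 0 ^ Suc (Suc n)) / h) \<longlongrightarrow> 0) (at 0)"
    by (rule Lim_transform_eventually) (auto simp: eventually_at_filter max_def)
  then show ?thesis using equal by (simp add: DERIV_def)
qed

text \<open>The profile is the cube of the positive part of
  \<open>1 - ((s - 1) / \<delta>)^2\<close> at the squared radius \<open>s\<close>; a cube still has
  a continuous second derivative. The gradient is displayed in the shape to which
  \<open>drift_radial\<close> applies.\<close>

lemma C2_shell_cutoff:
  assumes \<delta>: "0 < \<delta>"
  shows "\<exists>X f HX. C2 X (\<lambda>i (x::real^'d::finite). (2 * x $ i) *\<^sub>R f x) HX \<and>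
     (\<forall>x. X x \<noteq> (0::complex) \<longleftrightarrow> \<bar>x \<bullet> x - 1\<bar> < \<delta>)"
proof -
  define q where "q s = 1 - ((s - 1) / \<delta>)^2" for s :: real
  define q' where "q' s = - 2 * (s - 1) / \<delta>^2" for s :: real
  define b where "b s = max 0 (q s) ^ 3" for s
  define b' where "b' s = 3 * max 0 (q s) ^ 2 * q' s" for s
  define b'' where "b'' s = (6 * max 0 (q s) * q' s) * q' s + (- 2 / \<delta>^2) * (3 * max 0 (q s) ^ 2)" for s
  have m3: "((\<lambda>t. max 0 t ^ 3) has_real_derivative 3 * max 0 t ^ 2) (at t)" for t :: real
    using max_power_has_derivative[of 1 t] by (simp add: numeral_3_eq_3 numeral_2_eq_2)
  have m2: "((\<lambda>t. max 0 t ^ 2) has_real_derivative 2 * max 0 t) (at t)" for t :: real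
    using max_power_has_derivative[of 0 t] by (simp add: numeral_2_eq_2)
  have dq: "(q has_real_derivative q' s) (at s)" for s
    unfolding q_def q'_def using \<delta> by (auto intro!: derivative_eq_intros simp: power2_eq_square field_simps)
  have dq': "(q' has_real_derivative - 2 / \<delta>^2) (at s)" for s
    unfolding q'_def using \<delta> by (auto intro!: derivative_eq_intros simp: power2_eq_square power4_eq_xxxx)
  have "(b has_real_derivative b' s) (at s)" for s
    unfolding b_def b'_def by (rule DERIV_chain2[OF m3 dq])
  then have db: "((\<lambda>s. complex_of_real (b s)) has_vector_derivative complex_of_real (b' s)) (at s)" for s
    by (intro has_vector_derivative_of_real) (simp add: has_real_derivative_iff_has_vector_derivative)
  have "((\<lambda>s. 3 * max 0 (q s) ^ 2) has_real_derivative 6 * max 0 (q s) * q' s) (at s)" for s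
    using DERIV_cmult[OF DERIV_chain2[OF m2 dq], of 3 s] by (simp add: mult.assoc)
  from DERIV_mult[OF this dq'] have "(b' has_real_derivative b'' s) (at s)" for s
    unfolding b'_def b''_def .
  then have db': "((\<lambda>s. complex_of_real (b' s)) has_vector_derivative complex_of_real (b'' s)) (at s)" for s
    by (intro has_vector_derivative_of_real) (simp add: has_real_derivative_iff_has_vector_derivative)
  have cb: "continuous_on UNIV (\<lambda>s. complex_of_real (b'' s))"
    unfolding b''_def q_def q'_def by (intro continuous_intros) (use \<delta> in auto)
  have "b s \<noteq> 0 \<longleftrightarrow> \<bar>s - 1\<bar> < \<delta>" for s
  proof -
    have "b s \<noteq> 0 \<longleftrightarrow> ((s - 1) / \<delta>)^2 < 1^2" by (auto simp: b_def q_def max_def)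
    also have "\<dots> \<longleftrightarrow> \<bar>(s - 1) / \<delta>\<bar> < 1" by (simp only: abs_square_less_1 power_one)
    also have "\<dots> \<longleftrightarrow> \<bar>s - 1\<bar> < \<delta>" using \<delta> by simp
    finally show ?thesis .
  qed
  then show ?thesis
    by - (intro exI[of _ "\<lambda>x. complex_of_real (b (x \<bullet> x))"] exI[of _ "\<lambda>x. complex_of_real (b' (x \<bullet> x))"]
        exI conjI, rule C2_radial[OF db db' cb], simp)
qed

text \<open>The condition on the zero set is stable under products and ensures that multiplying by a
  cutoff does not give the zero class.\<close>

definition drift_eigen :: "real^'d::finite^'d \<Rightarrow> complex \<Rightarrow> (real^'d \<Rightarrow> complex) \<Rightarrow> bool" where
  "drift_eigen S \<mu> P \<longleftrightarrow> (\<exists>G H. C2 P G H \<and> (\<forall>x. drift S G x = \<mu> * P x)) \<and> negligible {x. P x = 0}"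

lemma drift_eigen_one: "drift_eigen S 0 (\<lambda>x. 1)"
  unfolding drift_eigen_def
  by (auto intro!: exI[of _ "\<lambda>i x. 0"] exI[of _ "\<lambda>i j x. 0"] simp: C2_def has_partial_const drift_def)

section \<open>Building drift eigenfunctions from linear forms\<close>

lemma drift_eigen_mult:
  assumes "drift_eigen S \<mu> P" "drift_eigen S \<nu> Q"
  shows "drift_eigen S (\<mu> + \<nu>) (\<lambda>x. P x * Q x)"
proof -
  obtain G H where P: "C2 P G H" "\<And>x. drift S G x = \<mu> * P x" using assms by (auto simp: drift_eigen_def)
  obtain G' H' where Q: "C2 Q G' H'" "\<And>x. drift S G' x = \<nu> * Q x" using assms by (auto simp: drift_eigen_def)
  have "{x. P x * Q x = 0} = {x. P x = 0} \<union> {x. Q x = 0}" by auto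
  then have "negligible {x. P x * Q x = 0}"
    using assms by (auto simp: drift_eigen_def)
  moreover have "drift S (\<lambda>i x. P x * G' i x + G i x * Q x) x = (\<mu> + \<nu>) * (P x * Q x)" for x
    unfolding drift_mult P Q by (simp add: algebra_simps)
  ultimately show ?thesis
    unfolding drift_eigen_def
    by - (intro conjI exI[of _ "\<lambda>i x. P x * G' i x + G i x * Q x"] exI, rule C2_mult[OF P(1) Q(1)], simp_all)
qed

lemma drift_eigen_power:
  assumes "drift_eigen S \<mu> P"
  shows "drift_eigen S (of_nat n * \<mu>) (\<lambda>x. P x ^ n)"
proof (induction n)
  case 0
  then show ?case using drift_eigen_one by simp
next
  case (Suc n)
  from drift_eigen_mult[OF assms Suc] show ?case by (simp add: algebra_simps)
qed

text \<open>For a kernel vector \<open>\<zeta>\<close>, the unconjugated pairing of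
  \<open>\<zeta>\<close> with \<open>x\<close> is mapped to that of the transpose of
  \<open>S\<close> applied to \<open>\<zeta>\<close>; skewness makes this \<open>- z\<close> times
  the form.\<close>

lemma drift_eigen_linear_form:
  fixes S :: "real^'d::finite^'d"
  assumes skew: "transpose S = - S" and det: "det (mat z - (\<chi> i j. complex_of_real (S$i$j))) = 0"
  shows "\<exists>P. drift_eigen S (- z) P"
proof -
  obtain \<zeta> where \<zeta>0: "\<zeta> \<noteq> 0" and \<zeta>: "(mat z - (\<chi> i j. complex_of_real (S$i$j))) *v \<zeta> = 0"
    using det_zero_kernel[OF det] by blast
  have S: "S $ j $ i = - S $ i $ j" for i j
    using arg_cong[OF skew, of "\<lambda>M. M $ i $ j"] by (simp add: transpose_def)
  have ev: "(\<Sum>i\<in>UNIV. complex_of_real (S$j$i) * \<zeta> $ i) = z * \<zeta> $ j" for j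
  proof -
    have "(\<Sum>i\<in>UNIV. (mat z $ j $ i - complex_of_real (S$j$i)) * \<zeta> $ i) = 0"
      using arg_cong[OF \<zeta>, of "\<lambda>v. v $ j"] by (simp add: matrix_vector_mult_def)
    moreover have "(\<Sum>i\<in>UNIV. mat z $ j $ i * \<zeta> $ i) = z * \<zeta> $ j"
      by (simp add: mat_def if_distrib[of "\<lambda>y. y * _"] cong: if_cong)
    ultimately show ?thesis by (simp add: left_diff_distrib sum_subtractf)
  qed
  define P where "P x = (\<Sum>j\<in>UNIV. \<zeta> $ j * complex_of_real (x $ j))" for x :: "real^'d"
  have "drift S (\<lambda>i x. \<zeta> $ i) x = - z * P x" for x
  proof -
    have "drift S (\<lambda>i x. \<zeta> $ i) x = (\<Sum>i\<in>UNIV. \<Sum>j\<in>UNIV. of_real (S$i$j * x$j) * \<zeta> $ i)"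
      by (simp add: drift_def scaleR_conv_of_real sum_distrib_right)
    also have "\<dots> = (\<Sum>j\<in>UNIV. \<Sum>i\<in>UNIV. of_real (S$i$j * x$j) * \<zeta> $ i)" by (rule sum.swap)
    also have "\<dots> = (\<Sum>j\<in>UNIV. - of_real (x$j) * (\<Sum>i\<in>UNIV. of_real (S$j$i) * \<zeta> $ i))"
    proof (rule sum.cong[OF refl])
      fix j
      show "(\<Sum>i\<in>UNIV. of_real (S$i$j * x$j) * \<zeta> $ i) = - of_real (x$j) * (\<Sum>i\<in>UNIV. of_real (S$j$i) * \<zeta> $ i)"
        unfolding sum_distrib_left by (rule sum.cong[OF refl]) (subst S, simp)
    qed
    also have "\<dots> = - z * P x"
      unfolding ev P_def sum_distrib_left by (rule sum.cong) auto
    finally show ?thesis .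
  qed
  moreover have "C2 P (\<lambda>i x. \<zeta> $ i) (\<lambda>i j x. 0)"
    unfolding P_def by (rule C2_linear_form)
  moreover have "negligible {x. P x = 0}"
  proof -
    \<comment> \<open>A complex zero satisfies two real linear equations, and at least one of the
      normals \<open>a\<close>, \<open>b\<close> is nonzero, so the zero set lies in a
      hyperplane.\<close>
    define a where "a = (\<chi> j. Re (\<zeta> $ j))"
    define b where "b = (\<chi> j. Im (\<zeta> $ j))"
    have "P x = 0 \<longleftrightarrow> a \<bullet> x = 0 \<and> b \<bullet> x = 0" for x
      by (simp add: P_def complex_eq_iff inner_vec_def a_def b_def)
    then have "{x. P x = 0} = {x. a \<bullet> x = 0} \<inter> {x. b \<bullet> x = 0}" by auto
    moreover have "a \<noteq> 0 \<or> b \<noteq> 0"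
      using \<zeta>0 by (auto simp: a_def b_def vec_eq_iff complex_eq_iff)
    ultimately show ?thesis
      using negligible_hyperplane[of a 0] negligible_hyperplane[of b 0]
      by (metis inf_le1 inf_le2 negligible_subset)
  qed
  ultimately show ?thesis unfolding drift_eigen_def by blast
qed

text \<open>Powers of linear forms have natural exponents; a negative \<open>n j\<close> is realised
  by the form belonging to the opposite eigenvalue, whence the sign \<open>e\<close>.\<close>

lemma drift_eigen_int_combination:
  fixes S :: "real^'d::finite^'d" and \<sigma> :: "nat \<Rightarrow> real" and n :: "nat \<Rightarrow> int"
  assumes skew: "transpose S = - S"
    and ev: "\<And>j e. j < k \<Longrightarrow> e = 1 \<or> e = - 1 \<Longrightarrow>
      det (mat (\<i> * of_real (e * \<sigma> j)) - (\<chi> i j. complex_of_real (S$i$j))) = 0"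
  shows "\<exists>P. drift_eigen S (- \<i> * of_real (\<Sum>j<k. of_int (n j) * \<sigma> j)) P"
  using ev
proof (induction k)
  case 0
  then show ?case using drift_eigen_one by auto
next
  case (Suc k)
  then obtain P where P: "drift_eigen S (- \<i> * of_real (\<Sum>j<k. of_int (n j) * \<sigma> j)) P" by auto
  define e where "e = (if n k \<ge> 0 then 1 else - 1 :: real)"
  have "e = 1 \<or> e = -1" by (auto simp: e_def)
  then obtain Q where "drift_eigen S (- (\<i> * of_real (e * \<sigma> k))) Q"
    using drift_eigen_linear_form[OF skew Suc.prems[of k e]] by auto
  from drift_eigen_mult[OF P drift_eigen_power[OF this, of "nat \<bar>n k\<bar>"]]
  obtain Q' where "drift_eigen S (- \<i> * of_real (\<Sum>j<k. of_int (n j) * \<sigma> j) + of_nat (nat \<bar>n k\<bar>) * (- (\<i> * of_real (e * \<sigma> k)))) Q'"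
    by blast
  moreover have "of_nat (nat \<bar>n k\<bar>) * complex_of_real e = of_int (n k)"
    by (auto simp: e_def)
  then have E: "of_nat (nat \<bar>n k\<bar>) * (- (\<i> * complex_of_real (e * \<sigma> k))) = - \<i> * complex_of_real (of_int (n k) * \<sigma> k)"
    by (metis (no_types, lifting) mult.assoc mult.commute mult_minus_right of_real_mult of_real_of_int_eq mult_minus_left)
  ultimately have "drift_eigen S (- \<i> * of_real (\<Sum>j<k. of_int (n j) * \<sigma> j) + - \<i> * of_real (of_int (n k) * \<sigma> k)) Q'"
    by (simp only: E)
  moreover have "- \<i> * of_real (\<Sum>j<k. of_int (n j) * \<sigma> j) + - \<i> * of_real (of_int (n k) * \<sigma> k)
      = - \<i> * complex_of_real (\<Sum>j<Suc k. of_int (n j) * \<sigma> j)"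
    by (simp add: algebra_simps)
  ultimately show ?case by metis
qed

text \<open>The radial cutoff is invisible to the drift, so the eigenvalue is kept. The product is
  nonzero almost everywhere on an open shell containing the unit vectors.\<close>

lemma drift_eigen_shell:
  fixes S :: "real^'d::finite^'d"
  assumes skew: "transpose S = - S" and P: "drift_eigen S \<mu> P" and \<delta>: "0 < \<delta>"
  shows "\<exists>g G H. C2 g G H \<and> (\<forall>x. drift S G x = \<mu> * g x) \<and> (\<forall>y. g y \<noteq> 0 \<longrightarrow> \<bar>y \<bullet> y - 1\<bar> \<le> \<delta>) \<and>
     \<not> (AE x in lebesgue. g x = 0)"
proof -
  obtain X f HX where CX: "C2 X (\<lambda>i (x::real^'d). (2 * x $ i) *\<^sub>R f x) HX"
     and X0: "\<And>x. X x \<noteq> (0::complex) \<longleftrightarrow> \<bar>x \<bullet> x - 1\<bar> < \<delta>"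
    using C2_shell_cutoff[OF \<delta>] by blast
  obtain G H where G: "C2 P G H" "\<And>x. drift S G x = \<mu> * P x" and N: "negligible {x. P x = 0}"
    using P by (auto simp: drift_eigen_def)
  define g where "g x = P x * X x" for x
  let ?G = "\<lambda>i x. P x * ((2 * x $ i) *\<^sub>R f x) + G i x * X x"
  have d: "drift S ?G x = \<mu> * g x" for x
    unfolding drift_mult drift_radial[OF skew] G g_def by simp
  have "\<not> (AE x in lebesgue. g x = 0)"
  proof
    assume "AE x in lebesgue. g x = 0"
    moreover have "AE x in lebesgue. P x \<noteq> 0"
      using AE_not_in[of "{x. P x = 0}" lebesgue] N by (simp add: negligible_iff_null_sets)
    ultimately have "AE x in lebesgue. x \<notin> {x::real^'d. \<bar>x \<bullet> x - 1\<bar> < \<delta>}"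
      by eventually_elim (use X0 in \<open>auto simp: g_def\<close>)
    moreover have o: "open {x::real^'d. \<bar>x \<bullet> x - 1\<bar> < \<delta>}"
      by (intro open_Collect_less continuous_intros)
    ultimately have "negligible {x::real^'d. \<bar>x \<bullet> x - 1\<bar> < \<delta>}"
      unfolding negligible_iff_null_sets by (subst AE_iff_null_sets) auto
    moreover have "axis undefined 1 \<in> {x::real^'d. \<bar>x \<bullet> x - 1\<bar> < \<delta>}"
      using \<delta> by (simp add: inner_axis_axis)
    ultimately show False
      using open_not_negligible[OF o] by blast
  qed
  moreover have "\<bar>y \<bullet> y - 1\<bar> \<le> \<delta>" if "g y \<noteq> 0" for y
    using that X0[of y] by (auto simp: g_def)
  ultimately show ?thesis
    using d unfolding g_def[abs_def]
    by - (intro exI[of _ "\<lambda>x. P x * X x"] exI[of _ ?G] exI conjI, rule C2_mult[OF G(1) CX], auto)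
qed

section \<open>Failure of the resolvent estimate\<close>

lemma norm_smult_vec: "norm (c *s (x::complex^'m)) = norm c * norm x"
  by (simp add: norm_vec_def norm_mult L2_set_right_distrib)

lemma bounded_linear_smult_vec: "bounded_linear (\<lambda>c. c *s (x::complex^'m))"
  by (rule bounded_linear_intro[of _ "norm x"]) (auto simp: norm_smult_vec vec_eq_iff algebra_simps)

lemma powr_add_le:
  assumes "0 \<le> s" "0 \<le> t" "0 \<le> p"
  shows "(s + t) powr p \<le> 2 powr p * (s powr p + t powr p :: real)"
proof -
  have "(s + t) powr p \<le> (2 * max s t) powr p"
    using assms by (intro powr_mono2) auto
  also have "\<dots> = 2 powr p * max s t powr p"
    using assms by (simp add: powr_mult)
  also have "max s t powr p \<le> s powr p + t powr p"
    by (auto simp: max_def)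
  finally show ?thesis by simp
qed

lemma Lp_norm_powr:
  assumes "0 < p"
  shows "Lp_norm p f powr p = (\<integral>x. norm (f x) powr p \<partial>lebesgue)"
  using assms by (simp add: Lp_norm_def powr_powr)

text \<open>It is the a priori bound in \<open>resolvent_set\<close> that is contradicted, by one
  mode whose residual is small relative to its norm.\<close>

lemma shell_mode_not_resolvent:
  fixes S :: "real^'d::finite^'d" and A B :: "complex^'m::finite^'m" and Q :: "real^'d \<Rightarrow> complex^'m^'m"
  assumes p: "1 < p" and skew: "transpose S = - S" and P: "drift_eigen S \<mu> P" and \<kappa>: "0 \<le> \<kappa>"
    and vh: "vh \<noteq> 0" and eig: "lm *s vh + complex_of_real (\<kappa>^2) *s (A *v vh) - \<mu> *s vh + B *v vh = 0"
    and Qm: "Q \<in> borel_measurable lebesgue"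
    and Qb: "\<exists>M. AE x in lebesgue. norm (Q x) \<le> M"
    and Qd: "\<forall>\<epsilon>>0. \<exists>R. AE x in lebesgue. norm x \<ge> R \<longrightarrow> norm (Q x) \<le> \<epsilon>"
  shows "lm \<notin> resolvent_set p (LQ p A S B Q)"
proof
  assume "lm \<in> resolvent_set p (LQ p A S B Q)"
  then obtain C0 where C0: "\<And>v w. LQ p A S B Q v w \<Longrightarrow> Lp_norm p v \<le> C0 * Lp_norm p (\<lambda>x. lm *s v x - w x)"
    unfolding resolvent_set_def by blast
  \<comment> \<open>The given constant may fail to be positive; \<open>C\<close> can be divided
    by.\<close>
  define C where "C = max C0 1"
  have C1: "1 \<le> C" by (simp add: C_def)
  have p0: "0 < p" using p by simp
  obtain K where K: "0 < K" "\<And>(N::complex^'m^'m) x. norm (N *v x) \<le> norm N * norm x * K"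
    using bounded_bilinear.pos_bounded[OF bounded_bilinear_matrix_vector] by blast
  define nv where "nv = norm vh"
  define a where "a = norm (A *v vh)"
  have nv: "0 < nv" using vh by (simp add: nv_def)
  have a0: "0 \<le> a" by (simp add: a_def)
  \<comment> \<open>The potential and the thickness of the shell cause errors that do not decay in
    \<open>R\<close>. Here \<open>\<epsilon>\<close> and next \<open>\<delta>\<close> allot
    \<open>nv / (16 * C)\<close> to each; the \<open>+ 1\<close> in \<open>\<delta>\<close> prevents
    a zero denominator, and the cap \<open>1/2\<close> keeps the shell away from the origin.\<close>
  define \<epsilon> where "\<epsilon> = 1 / (16 * C * K)"
  define \<delta> where "\<delta> = min (1/2) (nv / (16 * C * (\<kappa>^2 * a + 1)))"
  have ka: "0 < \<kappa>^2 * a + 1" using a0 by (simp add: add_nonneg_pos)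
  have \<epsilon>: "0 < \<epsilon>" using C1 K by (simp add: \<epsilon>_def)
  have \<delta>: "0 < \<delta>" "\<delta> \<le> 1/2" using C1 nv ka by (simp_all add: \<delta>_def)
  define \<eta> where "\<eta> = \<kappa>^2 * \<delta> * a + \<epsilon> * nv * K"
  have \<eta>0: "0 \<le> \<eta>" using \<delta> \<epsilon> nv K a0 by (simp add: \<eta>_def)
  have \<eta>: "\<eta> \<le> nv / (8 * C)"
  proof -
    have "\<kappa>^2 * \<delta> * a \<le> (\<kappa>^2 * a + 1) * \<delta>"
      using \<delta> by (simp add: algebra_simps)
    also have "\<dots> \<le> (\<kappa>^2 * a + 1) * (nv / (16 * C * (\<kappa>^2 * a + 1)))"
      using ka by (intro mult_left_mono) (auto simp: \<delta>_def)
    also have "\<dots> = nv / (16 * C)" using ka by simp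
    finally have "\<kappa>^2 * \<delta> * a \<le> nv / (16 * C)" .
    moreover have "\<epsilon> * nv * K = nv / (16 * C)" using K by (simp add: \<epsilon>_def)
    ultimately have "\<eta> \<le> nv / (16 * C) + nv / (16 * C)" by (simp add: \<eta>_def)
    also have "\<dots> = nv / (8 * C)" by simp
    finally show ?thesis .
  qed
  obtain R0 where R0: "AE x in lebesgue. norm x \<ge> R0 \<longrightarrow> norm (Q x) \<le> \<epsilon>"
    using Qd \<epsilon> by blast
  obtain M where M: "AE x in lebesgue. norm (Q x) \<le> M" using Qb by blast
  obtain g G H where g: "C2 g G H" and dg: "\<And>x. drift S G x = \<mu> * g x"
    and sh: "\<And>y. g y \<noteq> 0 \<Longrightarrow> \<bar>y \<bullet> y - 1\<bar> \<le> \<delta>" and gnz: "\<not> (AE x in lebesgue. g x = 0)"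
    using drift_eigen_shell[OF skew P \<delta>(1)] by blast
  have sg: "g y = 0" if "norm y > 2" for y
  proof (rule ccontr)
    assume "g y \<noteq> 0"
    then have "y \<bullet> y \<le> 3/2" using sh[of y] \<delta> by linarith
    moreover have "2^2 < norm y ^ 2" using that by (intro power_strict_mono) auto
    ultimately show False by (simp add: power2_norm_eq_inner)
  qed
  have gy: "norm y \<ge> 1/2" if "g y \<noteq> 0" for y
  proof (rule ccontr)
    assume "\<not> norm y \<ge> 1/2"
    then have "norm y ^ 2 < (1/2)^2" by (intro power_strict_mono) auto
    moreover have "y \<bullet> y \<ge> 1/2" using sh[OF that] \<delta> by linarith
    ultimately show False by (simp add: power2_norm_eq_inner power_divide)
  qed
  have cg: "continuous_on UNIV g" and cG: "continuous_on UNIV (G i)" and cH: "continuous_on UNIV (H i j)" for i j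
    using g by (auto simp: C2_def)
  \<comment> \<open>Collects the errors that \<open>shell_mode\<close> bounds with a factor
    \<open>1/R\<close>; it is independent of \<open>R\<close>, so its contribution scales like
    \<open>(a / R) powr p\<close>.\<close>
  define k where "k y = \<kappa> * CARD('d) * norm (g y) + 2 * \<kappa> * norm (\<Sum>i\<in>UNIV. y $ i *\<^sub>R G i y) + norm (lap H y)" for y
  have ck: "continuous_on UNIV k"
    unfolding k_def lap_def by (intro continuous_intros cg cG cH)
  have sk: "k y = 0" if "norm y > 2" for y
    using C2_zero_outside[OF g sg that] sg[OF that] by (simp add: k_def lap_def)
  have k0: "0 \<le> k y" for y using \<kappa> by (simp add: k_def)
  have cpow: "continuous_on UNIV (\<lambda>y. norm (f y) powr p)" if "continuous_on UNIV f"
    for f :: "real^'d \<Rightarrow> 'z::real_normed_vector"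
    by (intro continuous_on_powr' continuous_intros that) (use p0 in auto)
  define \<alpha> where "\<alpha> = (\<integral>y. norm (g y) powr p \<partial>lebesgue)"
  define \<beta> where "\<beta> = (\<integral>y. norm (k y) powr p \<partial>lebesgue)"
  have ig: "integrable lebesgue (\<lambda>y. norm (g y) powr p)"
    using Lp_cont[OF p0 cg sg] by (simp add: Lp_def)
  have \<alpha>: "0 < \<alpha>"
  proof -
    have "\<alpha> \<noteq> 0"
      using gnz integral_nonneg_eq_0_iff_AE[OF ig] by (simp add: \<alpha>_def)
    moreover have "0 \<le> \<alpha>" by (simp add: \<alpha>_def)
    ultimately show ?thesis by simp
  qed
  have "((\<lambda>R. (2 * C) powr p * ((a / R) powr p * \<beta>)) \<longlongrightarrow> (2 * C) powr p * (0 * \<beta>)) at_top"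
  proof (intro tendsto_intros tendsto_zero_powrI[of _ _ _ p])
    show "((\<lambda>R. a / R) \<longlongrightarrow> 0) at_top"
      by (intro real_tendsto_divide_at_top[OF tendsto_const] filterlim_ident)
    show "\<forall>\<^sub>F R in at_top. 0 \<le> a / R"
      using eventually_gt_at_top[of 0] by eventually_elim (use a0 in simp)
  qed (use p0 in auto)
  moreover have "0 < nv powr p * \<alpha> / 2" using nv \<alpha> by simp
  ultimately have "\<forall>\<^sub>F R in at_top. (2 * C) powr p * ((a / R) powr p * \<beta>) < nv powr p * \<alpha> / 2"
    by (intro order_tendstoD) auto
  \<comment> \<open>The mode lives where \<open>norm x \<ge> R / 2\<close>, so
    \<open>2 * R0 \<le> R\<close> puts its support into the region where \<open>Q\<close> is below
    \<open>\<epsilon>\<close>.\<close>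
  then have "\<forall>\<^sub>F R in at_top. (2 * C) powr p * ((a / R) powr p * \<beta>) < nv powr p * \<alpha> / 2 \<and> 1 \<le> R \<and> 2 * R0 \<le> R"
    by (intro eventually_conj eventually_ge_at_top)
  then obtain R where R\<beta>: "(2 * C) powr p * ((a / R) powr p * \<beta>) < nv powr p * \<alpha> / 2" and R1: "1 \<le> R" and RR: "2 * R0 \<le> R"
    using eventually_happens'[OF trivial_limit_at_top_linorder] by blast
  define y where "y x = (1/R) *\<^sub>R x" for x :: "real^'d"
  obtain u Gu Hu where u: "C2 u Gu Hu" and nu: "\<And>x. norm (u x) = norm (g (y x))"
    and du: "\<And>x. drift S Gu x = \<mu> * u x"
    and lu: "\<And>x. norm (lap Hu x + complex_of_real (\<kappa>^2) * u x) \<le> \<kappa>^2 * \<delta> * norm (g (y x)) + k (y x) / R"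
    using shell_mode[OF skew g dg sh R1 \<kappa>] unfolding y_def k_def by blast
  define v where "v x = u x *s vh" for x
  define Gv where "Gv i x = Gu i x *s vh" for i x
  define Hv where "Hv i j x = Hu i j x *s vh" for i j x
  have v: "C2 v Gv Hv"
    using C2_bounded_linear[OF bounded_linear_smult_vec u, of vh] unfolding v_def[abs_def] Gv_def[abs_def] Hv_def[abs_def] .
  have sv: "v x = 0" if "norm x > 2 * R" for x
  proof -
    have "norm (y x) > 2" using that R1 by (simp add: y_def pos_less_divide_eq)
    then have "norm (u x) = 0" unfolding nu using sg by simp
    then show ?thesis by (simp add: v_def)
  qed
  define w where "w x = (A *v lap Hv x + drift S Gv x) - B *v v x + Q x *v v x" for x
  have LQv: "LQ p A S B Q v w"
    using LQ_C2[OF p0 v sv Qm M] unfolding w_def[abs_def] .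
  have lv: "lap Hv x = lap Hu x *s vh" for x
  proof -
    interpret L: bounded_linear "\<lambda>c. c *s vh" by (rule bounded_linear_smult_vec)
    show ?thesis by (simp add: lap_def Hv_def L.sum)
  qed
  have dv: "drift S Gv x = drift S Gu x *s vh" for x
  proof -
    interpret L: bounded_linear "\<lambda>c. c *s vh" by (rule bounded_linear_smult_vec)
    show ?thesis by (simp add: drift_def Gv_def L.sum L.scaleR)
  qed
  \<comment> \<open>Subtracting \<open>u x\<close> times the dispersion relation cancels the terms
    with \<open>lm\<close>, \<open>\<mu>\<close> and \<open>B\<close>, leaving the Laplacian defect
    and the potential.\<close>
  have res: "lm *s v x - w x = - ((lap Hu x + complex_of_real (\<kappa>^2) * u x) *s (A *v vh)) - Q x *v v x" for x
  proof -
    have "u x *s (lm *s vh + complex_of_real (\<kappa>^2) *s (A *v vh) - \<mu> *s vh + B *v vh) = 0"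
      unfolding eig by simp
    then show ?thesis
      by (simp add: w_def lv dv du v_def vector_scalar_commute[symmetric] vec_eq_iff algebra_simps)
  qed
  have bnd: "AE x in lebesgue. norm (lm *s v x - w x) \<le> \<eta> * norm (g (y x)) + a / R * norm (k (y x))"
    using R0
  proof eventually_elim
    case (elim x)
    have "norm (Q x *v v x) \<le> \<epsilon> * (nv * norm (g (y x))) * K"
    proof (cases "g (y x) = 0")
      case True
      then have "v x = 0" using nu[of x] by (simp add: v_def)
      then show ?thesis using True by simp
    next
      case False
      have "norm (y x) = norm x / R" using R1 by (simp add: y_def)
      then have "R * norm (y x) = norm x" using R1 by simp
      moreover have "R * (1/2) \<le> R * norm (y x)" using gy[OF False] R1 by (intro mult_left_mono) auto
      ultimately have "R / 2 \<le> norm x" by simp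
      then have "norm (Q x) \<le> \<epsilon>" using elim RR by simp
      then show ?thesis
        using K \<epsilon> by (intro order_trans[OF K(2)] mult_right_mono mult_mono) (auto simp: v_def norm_smult_vec nu nv_def mult.commute)
    qed
    moreover have "norm (lm *s v x - w x) \<le> norm (lap Hu x + complex_of_real (\<kappa>^2) * u x) * a + norm (Q x *v v x)"
      unfolding res a_def norm_smult_vec[symmetric]
      by (rule order_trans[OF norm_triangle_ineq4]) (simp only: norm_minus_cancel order_refl)
    moreover have "norm (lap Hu x + complex_of_real (\<kappa>^2) * u x) * a \<le> (\<kappa>^2 * \<delta> * norm (g (y x)) + k (y x) / R) * a"
      by (intro mult_right_mono lu a0)
    ultimately show ?case
      using k0 by (simp add: \<eta>_def algebra_simps)
  qed
  have cy: "continuous_on UNIV (\<lambda>x. f (y x))" if "continuous_on UNIV f" for f :: "real^'d \<Rightarrow> 'z::real_normed_vector"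
    unfolding y_def by (rule continuous_on_compose2[OF that]) (auto intro!: continuous_intros)
  have sy: "norm (y x) > 2" if "norm x > 2 * R" for x
    using that R1 by (simp add: y_def pos_less_divide_eq)
  have igy: "integrable lebesgue (\<lambda>x. norm (g (y x)) powr p)"
    using Lp_cont[OF p0 cy[OF cg], of "2 * R"] sg sy by (simp add: Lp_def)
  have iky: "integrable lebesgue (\<lambda>x. norm (k (y x)) powr p)"
    using Lp_cont[OF p0 cy[OF ck], of "2 * R"] sk sy by (simp add: Lp_def)
  have Igy: "(\<integral>x. norm (g (y x)) powr p \<partial>lebesgue) = R ^ CARD('d) * \<alpha>"
    unfolding \<alpha>_def y_def using R1 by (intro integral_dilation[OF cpow[OF cg]]) simp
  have Iky: "(\<integral>x. norm (k (y x)) powr p \<partial>lebesgue) = R ^ CARD('d) * \<beta>"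
    unfolding \<beta>_def y_def using R1 by (intro integral_dilation[OF cpow[OF ck]]) simp
  have Iv: "(\<integral>x. norm (v x) powr p \<partial>lebesgue) = nv powr p * (R ^ CARD('d) * \<alpha>)"
  proof -
    have "norm (v x) powr p = nv powr p * norm (g (y x)) powr p" for x
      by (simp add: v_def norm_smult_vec nu nv_def powr_mult mult.commute)
    then show ?thesis by (simp add: Igy)
  qed
  have If: "(\<integral>x. norm (lm *s v x - w x) powr p \<partial>lebesgue)
      \<le> 2 powr p * (\<eta> powr p * (R ^ CARD('d) * \<alpha>) + (a / R) powr p * (R ^ CARD('d) * \<beta>))"
  proof -
    have "(\<integral>x. norm (lm *s v x - w x) powr p \<partial>lebesgue)
       \<le> (\<integral>x. 2 powr p * (\<eta> powr p * norm (g (y x)) powr p + (a / R) powr p * norm (k (y x)) powr p) \<partial>lebesgue)"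
    proof (rule integral_mono_AE')
      show "AE x in lebesgue. norm (lm *s v x - w x) powr p
          \<le> 2 powr p * (\<eta> powr p * norm (g (y x)) powr p + (a / R) powr p * norm (k (y x)) powr p)"
        using bnd
      proof eventually_elim
        case (elim x)
        have "norm (lm *s v x - w x) powr p \<le> (\<eta> * norm (g (y x)) + a / R * norm (k (y x))) powr p"
          using elim p0 by (intro powr_mono2) auto
        also have "\<dots> \<le> 2 powr p * ((\<eta> * norm (g (y x))) powr p + (a / R * norm (k (y x))) powr p)"
          using \<eta>0 a0 R1 p0 by (intro powr_add_le) auto
        finally show ?case
          using \<eta>0 a0 R1 by (simp only: powr_mult divide_nonneg_nonneg norm_ge_zero)
      qed
    qed (use igy iky in auto)
    also have "\<dots> = 2 powr p * (\<eta> powr p * (R ^ CARD('d) * \<alpha>) + (a / R) powr p * (R ^ CARD('d) * \<beta>))"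
      using igy iky Igy Iky by simp
    finally show ?thesis .
  qed
  let ?f = "\<lambda>x. lm *s v x - w x"
  have Lp0: "0 \<le> Lp_norm p h" for h :: "('d,'m) vfun" by (simp add: Lp_norm_def)
  have "Lp_norm p v \<le> C * Lp_norm p ?f"
    by (rule order_trans[OF C0[OF LQv] mult_right_mono]) (simp_all add: C_def Lp0)
  then have "Lp_norm p v powr p \<le> (C * Lp_norm p ?f) powr p"
    using Lp0 p0 by (intro powr_mono2) auto
  also have "\<dots> = C powr p * Lp_norm p ?f powr p"
    using Lp0 C1 by (simp add: powr_mult)
  finally have "nv powr p * (R ^ CARD('d) * \<alpha>) \<le> C powr p * (\<integral>x. norm (?f x) powr p \<partial>lebesgue)"
    unfolding Lp_norm_powr[OF p0] Iv .
  also have "\<dots> \<le> C powr p * (2 powr p * (\<eta> powr p * (R ^ CARD('d) * \<alpha>) + (a / R) powr p * (R ^ CARD('d) * \<beta>)))"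
    using If by (intro mult_left_mono) auto
  also have "\<dots> = R ^ CARD('d) * ((2 * C) powr p * \<eta> powr p * \<alpha> + (2 * C) powr p * ((a / R) powr p * \<beta>))"
    using C1 by (simp add: powr_mult algebra_simps)
  finally have "R ^ CARD('d) * (nv powr p * \<alpha>)
      \<le> R ^ CARD('d) * ((2 * C) powr p * \<eta> powr p * \<alpha> + (2 * C) powr p * ((a / R) powr p * \<beta>))"
    by (simp add: mult_ac)
  then have "nv powr p * \<alpha> \<le> (2 * C) powr p * \<eta> powr p * \<alpha> + (2 * C) powr p * ((a / R) powr p * \<beta>)"
    using R1 by (subst (asm) mult_le_cancel_left_pos) auto
  \<comment> \<open>With \<open>p > 1\<close> the power of \<open>1/4\<close> is at most
    \<open>1/4\<close>. Together with the bound of one half on the decaying part, the right-hand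
    side is below three quarters of the left.\<close>
  moreover have "(2 * C) powr p * \<eta> powr p \<le> nv powr p / 4"
  proof -
    have "(2 * C) powr p * \<eta> powr p = (2 * C * \<eta>) powr p"
      using C1 \<eta>0 by (simp add: powr_mult)
    also have "\<dots> \<le> (nv / 4) powr p"
      using \<eta> \<eta>0 C1 p0 by (intro powr_mono2) (auto simp: field_simps)
    also have "\<dots> = nv powr p * (1/4) powr p"
      using nv by (simp add: powr_mult[symmetric])
    also have "\<dots> \<le> nv powr p * (1/4) powr 1"
      using p by (intro mult_left_mono powr_mono') auto
    finally show ?thesis by simp
  qed
  then have "(2 * C) powr p * \<eta> powr p * \<alpha> \<le> nv powr p / 4 * \<alpha>"
    using \<alpha> by (intro mult_right_mono) auto
  moreover have "0 < nv powr p * \<alpha>" using nv \<alpha> by simp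
  ultimately show False using R\<beta> by (simp add: field_simps)
qed

section \<open>The dispersion set\<close>

lemma mat_vector_mult: "mat c *v x = c *s (x :: 'a::semiring_1^'n)"
  by (simp add: vec_eq_iff matrix_vector_mult_def mat_def if_distrib[of "\<lambda>y. y * _"] cong: if_cong)

text \<open>The frequency vectors enter the dispersion relation only through the two real numbers
  \<open>s\<close> and \<open>\<nu>\<close>.\<close>

definition disp_mat :: "complex^'m^'m \<Rightarrow> complex^'m^'m \<Rightarrow> real \<Rightarrow> real \<Rightarrow> complex \<Rightarrow> complex^'m^'m" where
  "disp_mat A B s \<nu> lm = mat lm + mat (complex_of_real s) ** A + mat (\<i> * complex_of_real \<nu>) + B"

lemma disp_mat_mult_vec:
  "disp_mat A B s \<nu> lm *v x = lm *s x + complex_of_real s *s (A *v x) + (\<i> * complex_of_real \<nu>) *s x + B *v x"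
  by (simp add: disp_mat_def matrix_vector_mult_add_rdistrib mat_vector_mult flip: matrix_vector_mul_assoc)

lemma disp_not_resolvent:
  fixes p :: real and A B :: "complex^'m::finite^'m" and S :: "real^'d::finite^'d" and Q :: "real^'d \<Rightarrow> complex^'m^'m"
    and \<sigma> :: "real list"
  assumes p: "1 < p"
    and skew: "transpose S = - S"
    and Qm: "Q \<in> borel_measurable lebesgue"
    and Qb: "\<exists>M. AE x in lebesgue. norm (Q x) \<le> M"
    and Qd: "\<forall>\<epsilon>>0. \<exists>R. AE x in lebesgue. norm x \<ge> R \<longrightarrow> norm (Q x) \<le> \<epsilon>"
    and charpoly: "\<forall>z::complex. det (mat z - (\<chi> i j. complex_of_real (S$i$j)))
                     = z ^ (CARD('d) - 2 * length \<sigma>) * (\<Prod>j<length \<sigma>. z^2 + complex_of_real ((\<sigma>!j)^2))"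
    and s: "0 \<le> s"
    and det: "det (disp_mat A B s (\<Sum>j<length \<sigma>. of_int (n!j) * \<sigma>!j) lm) = 0"
  shows "lm \<notin> resolvent_set p (LQ p A S B Q)"
proof -
  let ?\<nu> = "\<Sum>j<length \<sigma>. of_int (n!j) * \<sigma>!j"
  obtain vh where vh: "vh \<noteq> 0" and ker: "disp_mat A B s ?\<nu> lm *v vh = 0"
    using det_zero_kernel[OF det] by blast
  have "det (mat (\<i> * of_real (e * \<sigma> ! j)) - (\<chi> i j. complex_of_real (S$i$j))) = 0"
    if "j < length \<sigma>" "e = 1 \<or> e = - 1" for j and e :: real
  proof -
    \<comment> \<open>Either sign of the root annihilates the factor number \<open>j\<close> of the
      characteristic polynomial.\<close>
    have "(\<i> * complex_of_real (e * \<sigma> ! j))^2 + complex_of_real ((\<sigma>!j)^2) = 0"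
      using that by (auto simp: power_mult_distrib)
    then have "(\<Prod>l<length \<sigma>. (\<i> * complex_of_real (e * \<sigma> ! j))^2 + complex_of_real ((\<sigma>!l)^2)) = 0"
      using that by (intro prod_zero) auto
    then show ?thesis using charpoly by simp
  qed
  then obtain P where P: "drift_eigen S (- \<i> * of_real ?\<nu>) P"
    using drift_eigen_int_combination[OF skew, of "length \<sigma>" "\<lambda>j. \<sigma>!j" "\<lambda>j. n!j"] by blast
  show ?thesis
  \<comment> \<open>The wave number is \<open>sqrt s\<close>, and the drift eigenvalue
    \<open>- \<i> * \<nu>\<close> enters with a minus sign, reproducing the term
    \<open>+ \<i> * \<nu>\<close> of the dispersion matrix.\<close>
  proof (rule shell_mode_not_resolvent[OF p skew P _ vh _ Qm Qb Qd, of "sqrt s"])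
    show "lm *s vh + complex_of_real ((sqrt s)^2) *s (A *v vh) - (- \<i> * of_real ?\<nu>) *s vh + B *v vh = 0"
      using ker s by (simp add: disp_mat_mult_vec vec_eq_iff)
  qed (use s in simp)
qed

text \<open>Conjugation by \<open>Y\<close> leaves scalar matrices alone and diagonalises
  \<open>A\<close> and \<open>B\<close> together, so the dispersion relation splits into scalar
  factors.\<close>

lemma det_disp_mat_diag:
  fixes A B Y Yi :: "complex^'m::finite^'m"
  assumes Y: "Y ** Yi = mat 1" "Yi ** Y = mat 1"
    and A: "is_diag (Yi ** A ** Y)" and B: "is_diag (Yi ** B ** Y)"
  shows "det (disp_mat A B s \<nu> lm) =
    (\<Prod>i\<in>UNIV. lm + complex_of_real s * (Yi ** A ** Y) $ i $ i + \<i> * complex_of_real \<nu> + (Yi ** B ** Y) $ i $ i)"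
proof -
  let ?A = "Yi ** A ** Y" and ?B = "Yi ** B ** Y"
  have conj: "Yi ** disp_mat A B s \<nu> lm ** Y = disp_mat ?A ?B s \<nu> lm"
  proof -
    have "Yi *v (Y *v x) = x" for x
      by (simp add: matrix_vector_mul_assoc Y)
    then show ?thesis
      by (simp add: matrix_eq disp_mat_mult_vec matrix_vector_right_distrib vector_scalar_commute flip: matrix_vector_mul_assoc)
  qed
  have "det Yi * det Y = 1" using Y by (metis det_mul det_I)
  then have "det (disp_mat A B s \<nu> lm) = det (Yi ** disp_mat A B s \<nu> lm ** Y)"
    by (simp add: det_mul mult.commute mult.left_commute)
  also have "\<dots> = (\<Prod>i\<in>UNIV. disp_mat ?A ?B s \<nu> lm $ i $ i)"
    unfolding conj
  proof (rule det_diagonal)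
    fix i j :: 'm assume "i \<noteq> j"
    have "(mat c ** M) $ i $ j = c * M $ i $ j" for c :: complex and M :: "complex^'m^'m"
      by (simp add: matrix_matrix_mult_def mat_def if_distrib[of "\<lambda>y. y * _"] cong: if_cong)
    then show "disp_mat ?A ?B s \<nu> lm $ i $ j = 0"
      using A B \<open>i \<noteq> j\<close> by (simp add: disp_mat_def is_diag_def mat_def[of lm] mat_def[of "\<i> * _"])
  qed
  also have "\<dots> = (\<Prod>i\<in>UNIV. lm + complex_of_real s * ?A $ i $ i + \<i> * complex_of_real \<nu> + ?B $ i $ i)"
  proof -
    have "(mat c ** M) $ i $ i = c * M $ i $ i" for c :: complex and M :: "complex^'m^'m" and i
      by (simp add: matrix_matrix_mult_def mat_def if_distrib[of "\<lambda>y. y * _"] cong: if_cong)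
    then show ?thesis
      by (simp add: disp_mat_def mat_def[of lm] mat_def[of "\<i> * _"])
  qed
  finally show ?thesis .
qed

text \<open>Testing \<open>cond_A4\<close> with \<open>z = w\<close> in the kernel of
  \<open>A\<close> makes the left side zero, so \<open>A\<close> is invertible; the product of the
  diagonal entries of its diagonal form is then nonzero.\<close>

lemma cond_A4_diag_nonzero:
  fixes A Y Yi :: "complex^'m::finite^'m"
  assumes A4: "cond_A4 p A" and Y: "Y ** Yi = mat 1" "Yi ** Y = mat 1" and A: "is_diag (Yi ** A ** Y)"
  shows "(Yi ** A ** Y) $ i $ i \<noteq> 0"
proof
  assume 0: "(Yi ** A ** Y) $ i $ i = 0"
  have "det A \<noteq> 0"
  proof
    assume "det A = 0"
    then obtain w where w: "w \<noteq> 0" "A *v w = 0" using det_zero_kernel by blast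
    obtain \<gamma> where "\<gamma> > 0" "\<And>z w. (norm z)^2 * Re (cinner w (A *v w)) + (p - 2) * Re (cinner w z) * Re (cinner z (A *v w))
        \<ge> \<gamma> * (norm z)^2 * (norm w)^2"
      using A4 unfolding cond_A4_def by blast
    from this(1) this(2)[of w w] show False
      using w by (simp add: cinner_def mult_le_0_iff)
  qed
  moreover have "det Yi * det Y = 1" using Y by (metis det_mul det_I)
  ultimately have "det (Yi ** A ** Y) \<noteq> 0" by (auto simp: det_mul)
  moreover have "det (Yi ** A ** Y) = (\<Prod>i\<in>UNIV. (Yi ** A ** Y) $ i $ i)"
    using A by (intro det_diagonal) (auto simp: is_diag_def)
  ultimately show False using 0 by auto
qed

text \<open>Every \<open>s \<ge> 0\<close> is a sum of squares with only the first entry nonzero.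
  That entry is put into the first list if \<open>\<sigma>\<close> is nonempty and otherwise into
  the second, whose length is then \<open>d\<close>.\<close>

lemma disp_set_iff:
  assumes "2 \<le> d" "2 * length \<sigma> \<le> d"
  shows "lm \<in> disp_set A B \<sigma> d \<longleftrightarrow>
    (\<exists>s\<ge>0. \<exists>n. length n = length \<sigma> \<and> det (disp_mat A B s (\<Sum>j<length \<sigma>. of_int (n!j) * \<sigma>!j) lm) = 0)"
    (is "?L \<longleftrightarrow> ?R")
proof
  assume ?L
  then obtain \<omega> \<rho> :: "real list" and n where
    1: "length n = length \<sigma>" "det (disp_mat A B ((\<Sum>t\<leftarrow>\<omega>. t^2) + (\<Sum>t\<leftarrow>\<rho>. t^2)) (\<Sum>j<length \<sigma>. of_int (n!j) * \<sigma>!j) lm) = 0"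
    unfolding disp_set_def disp_mat_def by blast
  have "0 \<le> (\<Sum>t\<leftarrow>\<omega>. t^2) + (\<Sum>t\<leftarrow>\<rho>. t^2)"
    by (intro add_nonneg_nonneg sum_list_nonneg) auto
  with 1 show ?R by blast
next
  assume ?R
  then obtain s n where s: "0 \<le> s" and n: "length n = length \<sigma>"
    "det (disp_mat A B s (\<Sum>j<length \<sigma>. of_int (n!j) * \<sigma>!j) lm) = 0" by blast
  have "\<exists>(\<omega>::real list) (\<rho>::real list). length \<omega> = length \<sigma> \<and> length \<rho> = d - 2 * length \<sigma> \<and>
     (\<Sum>t\<leftarrow>\<omega>. t^2) + (\<Sum>t\<leftarrow>\<rho>. t^2) = s"
  proof (cases "length \<sigma>")
    case 0
    then show ?thesis using assms s
      by (intro exI[of _ "[]"] exI[of _ "sqrt s # replicate (d - 1) 0"]) (auto simp: sum_list_replicate)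
  next
    case (Suc k)
    then show ?thesis using assms s
      by (intro exI[of _ "sqrt s # replicate k 0"] exI[of _ "replicate (d - 2 * length \<sigma>) 0"])
         (auto simp: sum_list_replicate)
  qed
  then show ?L
    using n unfolding disp_set_def disp_mat_def by blast
qed

theorem theorem3p1:
  fixes p :: real
    and A B :: "complex^'m^'m"
    and S :: "real^'d^'d"
    and Q :: "real^'d \<Rightarrow> complex^'m^'m"
    and \<sigma> :: "real list"
  assumes d2: "CARD('d) \<ge> 2"
    and p: "1 < p"
    and skew: "transpose S = - S"
    and A4: "cond_A4 p A"
    and diag: "simult_diagonalizable A B"
    and Q_meas: "Q \<in> borel_measurable lebesgue"
    and Q_bdd: "\<exists>M. AE x in lebesgue. norm (Q x) \<le> M"
    and Q_decay: "\<forall>\<epsilon>>0. \<exists>R. AE x in lebesgue. norm x \<ge> R \<longrightarrow> norm (Q x) \<le> \<epsilon>"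
    and sigma_nz: "\<forall>j<length \<sigma>. \<sigma>!j \<noteq> 0"
    and sigma_eig: "2 * length \<sigma> \<le> CARD('d)"
    and charpoly: "\<forall>z::complex. det (mat z - (\<chi> i j. complex_of_real (S$i$j)))
                     = z ^ (CARD('d) - 2 * length \<sigma>) * (\<Prod>j<length \<sigma>. z^2 + complex_of_real ((\<sigma>!j)^2))"
  shows "disp_set A B \<sigma> CARD('d) \<subseteq> ess_spectrum p (LQ p A S B Q)"
proof
  fix lm assume "lm \<in> disp_set A B \<sigma> CARD('d)"
  then obtain s n where s: "0 \<le> s" and det: "det (disp_mat A B s (\<Sum>j<length \<sigma>. of_int (n!j) * \<sigma>!j) lm) = 0"
    unfolding disp_set_iff[OF d2 sigma_eig] by blast
  let ?\<nu> = "\<Sum>j<length \<sigma>. of_int (n!j) * \<sigma>!j"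
  have spec: "l \<in> spectrum_op p (LQ p A S B Q)" if "0 \<le> s'" "det (disp_mat A B s' ?\<nu> l) = 0" for s' l
    using disp_not_resolvent[OF p skew Q_meas Q_bdd Q_decay charpoly that] by (simp add: spectrum_op_def)
  obtain Y Yi :: "complex^'m^'m" where Y: "Y ** Yi = mat 1" "Yi ** Y = mat 1"
    and DA: "is_diag (Yi ** A ** Y)" and DB: "is_diag (Yi ** B ** Y)"
    using diag unfolding simult_diagonalizable_def by blast
  note dd = det_disp_mat_diag[OF Y DA DB]
  obtain i where i: "lm + complex_of_real s * (Yi ** A ** Y) $ i $ i + \<i> * complex_of_real ?\<nu> + (Yi ** B ** Y) $ i $ i = 0"
    using det unfolding dd by (auto simp: prod_zero_iff)
  define a where "a = (Yi ** A ** Y) $ i $ i"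
  have a: "a \<noteq> 0" unfolding a_def by (rule cond_A4_diag_nonzero[OF A4 Y DA])
  \<comment> \<open>Raising \<open>s\<close> by \<open>t\<close> at fixed \<open>\<nu>\<close> moves
    the root of the factor with index \<open>i\<close> by \<open>- t * a\<close>; the case
    \<open>t = 0\<close> is \<open>lm\<close> itself.\<close>
  have curve: "lm - complex_of_real t * a \<in> spectrum_op p (LQ p A S B Q)" if "0 \<le> t" for t
  proof (rule spec[of "s + t"])
    show "det (disp_mat A B (s + t) ?\<nu> (lm - complex_of_real t * a)) = 0"
      unfolding dd by (rule prod_zero) (use i in \<open>auto intro!: exI[of _ i] simp: a_def algebra_simps\<close>)
  qed (use s that in simp)
  have "\<not> lm isolated_in spectrum_op p (LQ p A S B Q)"
  proof
    assume "lm isolated_in spectrum_op p (LQ p A S B Q)"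
    then obtain T where T: "open T" "T \<inter> spectrum_op p (LQ p A S B Q) = {lm}"
      unfolding isolated_in_def by blast
    then obtain e where e: "0 < e" "ball lm e \<subseteq> T"
      by (metis IntD1 openE singletonI)
    \<comment> \<open>Places the point at distance \<open>e / 2\<close> from \<open>lm\<close>,
      inside the isolating ball but different from \<open>lm\<close>.\<close>
    define t where "t = e / (2 * norm a)"
    have t: "0 < t" using e a by (simp add: t_def)
    have "dist lm (lm - complex_of_real t * a) = t * norm a"
      using t by (simp add: dist_norm norm_mult)
    also have "\<dots> < e" using e a by (simp add: t_def)
    finally have "lm - complex_of_real t * a \<in> T" using e by auto
    then have "lm - complex_of_real t * a \<in> T \<inter> spectrum_op p (LQ p A S B Q)"
      using curve[of t] t by simp
    then have "lm - complex_of_real t * a = lm"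
      unfolding T(2) by simp
    then show False using t a by simp
  qed
  then show "lm \<in> ess_spectrum p (LQ p A S B Q)"
    using curve[of 0] by (simp add: ess_spectrum_def point_spectrum_def)
qed

end
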